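(* For every integer $\gamma\ge 2$, there exists an algorithm for the minimum spanning tree problem under explorable uncertainty with predictions that is $\left(1+\frac{1}{\gamma}\right)$-consistent and $\gamma$-robust.
   Context: Minimum spanning tree (MST) problem under explorable uncertainty with predictions: an instance is a connected (multi)graph $G=(V,E)$. Each edge $e$ has an unknown true weight $w_e\in\mathbb{R}_+$ and a known uncertainty interval $I_e$, which is either an open interval $(L_e,U_e)$ containing $w_e$ (edge $e$ is non-trivial) or the trivial interval $\{w_e\}$ (then $L_e=U_e=w_e$). Querying an edge reveals $w_e$. A set $Q\subseteq E$ is a feasible query set if there is a spanning tree $T$ that is a minimum spanning tree for every weight assignment that equals $w_e$ for $e\in Q$ and takes arbitrary values in $I_e$ for $e\notin Q$. $\mathrm{OPT}$ denotes a feasible query set of minimum cardinality. An algorithm queries edges adaptively (each choice may depend on previously revealed values; true values may be chosen adversarially) until its set $\mathrm{ALG}$ of queried edges is feasible. In addition, for every edge $e$ the algorithm is given a (possibly wrong) prediction $\hat w_e\in I_e$. An algorithm is $\rho$-competitive if $|\mathrm{ALG}|\le\rho\,|\mathrm{OPT}|$ on every instance; it is $\alpha$-consistent if it is $\alpha$-competitive on all instances in which $\hat w_e=w_e$ for all $e$, and $\beta$-robust if it is $\beta$-competitive on all instances regardless of the predictions. *)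

theory Defs imports Complex_Main begin

text \<open>Undirected multigraphs. An edge is an abstract name whose end points form an unordered pair,
  so parallel edges are allowed; an edge \<open>e\<close> with \<open>ends G e = {v}\<close> is a loop.\<close>

record ('v, 'e) multigraph =
  verts :: "'v set"
  edges :: "'e set"
  ends :: "'e \<Rightarrow> 'v set"

definition multigraph :: "('v, 'e, 'z) multigraph_scheme \<Rightarrow> bool" where
  "multigraph G \<longleftrightarrow> finite (verts G) \<and> verts G \<noteq> {} \<and> finite (edges G) \<and>
     (\<forall>e\<in>edges G. \<exists>u\<in>verts G. \<exists>v\<in>verts G. ends G e = {u, v})"

definition adjacency :: "('v, 'e, 'z) multigraph_scheme \<Rightarrow> 'e set \<Rightarrow> ('v \<times> 'v) set" where
  "adjacency G F = {(u, v). \<exists>e\<in>F. ends G e = {u, v}}"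

definition connects :: "('v, 'e, 'z) multigraph_scheme \<Rightarrow> 'e set \<Rightarrow> bool" where
  "connects G F \<longleftrightarrow> (\<forall>u\<in>verts G. \<forall>v\<in>verts G. (u, v) \<in> (adjacency G F)\<^sup>*)"

text \<open>A cycle visits pairwise distinct vertices \<open>vs\<close> along pairwise distinct edges \<open>es\<close>; length 1 is
  a loop, and length 2 is a pair of parallel edges.\<close>

definition is_cycle :: "('v, 'e, 'z) multigraph_scheme \<Rightarrow> 'v list \<Rightarrow> 'e list \<Rightarrow> bool" where
  "is_cycle G vs es \<longleftrightarrow> es \<noteq> [] \<and> length vs = length es \<and> distinct vs \<and> distinct es \<and>
     (\<forall>i<length es. ends G (es ! i) = {vs ! i, vs ! (Suc i mod length es)})"

definition spanning_tree :: "('v, 'e, 'z) multigraph_scheme \<Rightarrow> 'e set \<Rightarrow> bool" where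
  "spanning_tree G T \<longleftrightarrow> T \<subseteq> edges G \<and> connects G T \<and>
     \<not> (\<exists>vs es. is_cycle G vs es \<and> set es \<subseteq> T)"

definition minimum_spanning_tree ::
    "('v, 'e, 'z) multigraph_scheme \<Rightarrow> ('e \<Rightarrow> real) \<Rightarrow> 'e set \<Rightarrow> bool" where
  "minimum_spanning_tree G w T \<longleftrightarrow> is_arg_min (\<lambda>S. \<Sum>e\<in>S. w e) (spanning_tree G) T"

text \<open>The input is what is known before any query. The true weights are not part of it; they are
  the separate argument \<open>w\<close> below.\<close>

record ('v, 'e) mst_input = "('v, 'e) multigraph" +
  lower :: "'e \<Rightarrow> real"
  upper :: "'e \<Rightarrow> real"
  prediction :: "'e \<Rightarrow> real"

definition uncertainty_interval :: "('v, 'e) mst_input \<Rightarrow> 'e \<Rightarrow> real set" where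
  "uncertainty_interval P e =
     (if lower P e = upper P e then {lower P e} else {lower P e<..<upper P e})"

text \<open>Only the true weights are required to be nonnegative; \<open>lower P e\<close> may be negative.\<close>

definition mst_instance :: "('v, 'e) mst_input \<Rightarrow> ('e \<Rightarrow> real) \<Rightarrow> bool" where
  "mst_instance P w \<longleftrightarrow> multigraph P \<and> connects P (edges P) \<and>
     (\<forall>e\<in>edges P. 0 \<le> w e \<and> w e \<in> uncertainty_interval P e \<and>
        prediction P e \<in> uncertainty_interval P e)"

definition possible_weights ::
    "('v, 'e) mst_input \<Rightarrow> ('e \<Rightarrow> real) \<Rightarrow> 'e set \<Rightarrow> ('e \<Rightarrow> real) \<Rightarrow> bool" where
  "possible_weights P w Q w' \<longleftrightarrow>
     (\<forall>e\<in>edges P. if e \<in> Q then w' e = w e else w' e \<in> uncertainty_interval P e)"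

definition feasible_query_set :: "('v, 'e) mst_input \<Rightarrow> ('e \<Rightarrow> real) \<Rightarrow> 'e set \<Rightarrow> bool" where
  "feasible_query_set P w Q \<longleftrightarrow> Q \<subseteq> edges P \<and>
     (\<exists>T. spanning_tree P T \<and>
        (\<forall>w'. possible_weights P w Q w' \<longrightarrow> minimum_spanning_tree P w' T))"

definition optimal_query_set :: "('v, 'e) mst_input \<Rightarrow> ('e \<Rightarrow> real) \<Rightarrow> 'e set \<Rightarrow> bool" where
  "optimal_query_set P w Q \<longleftrightarrow> is_arg_min card (feasible_query_set P w) Q"

text \<open>A deterministic adaptive algorithm selects the next edge to query from the input and the
  chronological list of the queries made so far with the values they revealed.\<close>

type_synonym ('v, 'e) query_algorithm = "('v, 'e) mst_input \<Rightarrow> ('e \<times> real) list \<Rightarrow> 'e"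

definition queried :: "('e \<times> real) list \<Rightarrow> 'e set" where
  "queried h = fst ` set h"

inductive reaches ::
    "('v, 'e) query_algorithm \<Rightarrow> ('v, 'e) mst_input \<Rightarrow> ('e \<Rightarrow> real) \<Rightarrow> ('e \<times> real) list \<Rightarrow> bool"
  for A :: "('v, 'e) query_algorithm" and P :: "('v, 'e) mst_input" and w :: "'e \<Rightarrow> real" where
  start: "reaches A P w []"
| query: "reaches A P w h \<Longrightarrow> \<not> feasible_query_set P w (queried h) \<Longrightarrow> A P h = e \<Longrightarrow>
    reaches A P w (h @ [(e, w e)])"

text \<open>There is at most one such set: querying goes on exactly as long as the queried set is not
  feasible. There is none if the algorithm never reaches a feasible set or ever queries outside
  \<open>edges P\<close>.\<close>

definition final_query_set ::
    "('v, 'e) query_algorithm \<Rightarrow> ('v, 'e) mst_input \<Rightarrow> ('e \<Rightarrow> real) \<Rightarrow> 'e set \<Rightarrow> bool" where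
  "final_query_set A P w Q \<longleftrightarrow>
     (\<exists>h. reaches A P w h \<and> Q = queried h \<and> feasible_query_set P w Q)"

definition competitive_on ::
    "(('v, 'e) mst_input \<Rightarrow> ('e \<Rightarrow> real) \<Rightarrow> bool) \<Rightarrow> real \<Rightarrow> ('v, 'e) query_algorithm \<Rightarrow> bool" where
  "competitive_on C \<rho> A \<longleftrightarrow>
     (\<forall>P w. mst_instance P w \<and> C P w \<longrightarrow>
        (\<exists>ALG. final_query_set A P w ALG \<and>
           (\<forall>OPT. optimal_query_set P w OPT \<longrightarrow> real (card ALG) \<le> \<rho> * real (card OPT))))"

definition consistent :: "real \<Rightarrow> ('v, 'e) query_algorithm \<Rightarrow> bool" where
  "consistent \<alpha> A \<longleftrightarrow> competitive_on (\<lambda>P w. \<forall>e\<in>edges P. prediction P e = w e) \<alpha> A"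

definition robust :: "real \<Rightarrow> ('v, 'e) query_algorithm \<Rightarrow> bool" where
  "robust \<beta> A \<longleftrightarrow> competitive_on (\<lambda>P w. True) \<beta> A"

end

(*
A query set is feasible iff some spanning tree T satisfies: for every exchange of a tree edge e for a
non-tree edge f, the upper limit of e is at most the lower limit of f. Hence everything can be argued
with the symmetric exchange property of spanning trees alone.

If no minimum spanning tree for the lower limits is also one for the upper limits, some edge belongs to
every feasible set. Otherwise let T be such a common tree. If e has the largest upper limit among the
edges exchangeable for f, and the intervals overlap in the wrong order, then {e, f} meets every feasible
set, and e belongs to every feasible set unless w f is at least the upper limit of e (and dually).
Querying such pairs gives a factor of 2.

With predictions, first collect a chain of edges z that become mandatory if a reason x has its
predicted weight. When no further step is possible, a minimum vertex cover of the remaining conflict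
graph makes the query set feasible if the predictions are right, and a matching of the cover edges to
edges outside the cover (Hall) supplies reasons for them as well. A reason is queried only if it is
itself a z or is the reason of at least gamma edges: this costs at most a 1/gamma fraction of the
queries. A reason with fewer than gamma edges forms, together with these edges, a group of at most
gamma edges which meets every feasible set. As soon as a prediction turns out to be wrong, the groups
begun so far are completed and the 2-competitive strategy takes over.

An algorithm may only depend on the revealed weights, so strategies are represented by an inductively
defined winning region; the algorithm picks any query that stays inside it.
*)

theory Submission imports Defs begin

section \<open>Charging queries to hit sets\<close>

text \<open>The edges are split into groups, one for each value \<open>a\<close> of \<open>x\<close>: all \<open>z t\<close> with \<open>x t = a\<close>,
  together with \<open>a\<close> unless \<open>a\<close> is itself one of the \<open>z t\<close>.\<close>

lemma group_charging:
  fixes z x :: "nat \<Rightarrow> 'e"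
  assumes inj: "inj_on z {..<k}" and \<gamma>: "2 \<le> \<gamma>"
    and hit: "\<And>t. t < k \<Longrightarrow> z t \<in> F \<or> x t \<in> F"
    and light: "\<And>t. t < k \<Longrightarrow> \<not> H (x t) \<Longrightarrow>
      x t \<notin> z ` {..<k} \<and> card {s. s < k \<and> x s = x t} < \<gamma>"
    and heavy: "\<And>t. t < k \<Longrightarrow> H (x t) \<Longrightarrow> z t \<notin> F \<Longrightarrow>
      x t \<notin> z ` {..<k} \<and> (\<forall>s<k. x s = x t \<longrightarrow> s \<noteq> t \<longrightarrow> z s \<in> F)"
  shows "card (z ` {..<k} \<union> x ` {..<k}) \<le> \<gamma> * card (F \<inter> (z ` {..<k} \<union> x ` {..<k}))"
proof -
  define I where "I a = {s. s < k \<and> x s = a}" for a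
  define G where "G a = z ` I a \<union> ({a} - z ` {..<k})" for a
  let ?X = "x ` {..<k}" and ?S = "z ` {..<k} \<union> x ` {..<k}"
  have I: "finite (I a)" "I a \<subseteq> {..<k}" for a unfolding I_def by auto
  have finG: "finite (G a)" for a using I unfolding G_def by auto
  have cI: "card (z ` J) = card J" if "J \<subseteq> {..<k}" for J
    using card_image[OF inj_on_subset[OF inj that]] .
  have S: "?S = (\<Union>a\<in>?X. G a)" unfolding G_def I_def by auto
  have group: "card (G a) \<le> \<gamma> * card (F \<inter> G a)" if a: "a \<in> ?X" for a
  proof -
    obtain t where t: "t < k" "x t = a" using a by auto
    have le: "card (G a) \<le> Suc (card (I a))"
    proof -
      have "card (G a) \<le> card (z ` I a) + card ({a} - z ` {..<k})"
        unfolding G_def by (rule card_Un_le)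
      moreover have "card ({a} - z ` {..<k}) \<le> card {a}" by (rule card_mono) auto
      ultimately show ?thesis using cI[OF I(2), of a] by simp
    qed
    have tI: "t \<in> I a" using t unfolding I_def by auto
    then have pos: "1 \<le> card (I a)" using I(1)[of a] by (metis One_nat_def Suc_leI card_gt_0_iff empty_iff)
    show ?thesis
    proof (cases "H a")
      \<comment> \<open>A light group has at most \<gamma> edges, so a single hit pays for
        it.\<close>
      case False
      then have "a \<notin> z ` {..<k}" "card (I a) < \<gamma>" using light[OF t(1)] t(2) unfolding I_def by auto
      moreover have "F \<inter> G a \<noteq> {}"
        using hit[OF t(1)] t tI \<open>a \<notin> z ` {..<k}\<close> unfolding G_def by auto
      then have "1 \<le> card (F \<inter> G a)" using finG[of a] by (simp add: Suc_le_eq card_gt_0_iff)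
      ultimately have "card (G a) \<le> \<gamma> * 1" "\<gamma> * 1 \<le> \<gamma> * card (F \<inter> G a)"
        using le by (simp_all del: mult_1_right)
      then show ?thesis by linarith
    next
      case True
      \<comment> \<open>A heavy group receives at least as many hits as its fibre has indices, and
        contains at most one further edge. As the fibre is nonempty, a factor of 2 suffices.\<close>
      have "card (I a) \<le> card (F \<inter> G a)"
      proof (cases "\<forall>s\<in>I a. z s \<in> F")
        case True
        then have "z ` I a \<subseteq> F \<inter> G a" unfolding G_def by auto
        then show ?thesis using card_mono[of "F \<inter> G a" "z ` I a"] finG[of a] cI[OF I(2), of a] by simp
      next
        case False
        then obtain s where s: "s \<in> I a" "z s \<notin> F" by auto
        then have sk: "s < k" "x s = a" unfolding I_def by auto
        then have *: "a \<notin> z ` {..<k}" "\<And>r. r \<in> I a \<Longrightarrow> r \<noteq> s \<Longrightarrow> z r \<in> F"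
          using heavy[of s] \<open>H a\<close> s unfolding I_def by auto
        have "a \<in> F" using hit[OF sk(1)] s sk by auto
        \<comment> \<open>The one missed edge \<open>z s\<close> is replaced by its reason
          \<open>a\<close>, so the number of hits is still that of the fibre.\<close>
        then have "insert a (z ` (I a - {s})) \<subseteq> F \<inter> G a" using * unfolding G_def by auto
        moreover have "card (insert a (z ` (I a - {s}))) = Suc (card (I a - {s}))"
        proof -
          have "a \<notin> z ` (I a - {s})" using *(1) I(2)[of a] by auto
          moreover have "I a - {s} \<subseteq> {..<k}" using I(2)[of a] by auto
          ultimately show ?thesis using I(1)[of a] cI by simp
        qed
        moreover have "Suc (card (I a - {s})) = card (I a)" using s(1) I(1)[of a] pos by simp
        ultimately show ?thesis using card_mono[of "F \<inter> G a"] finG[of a] by (metis finite_Int)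
      qed
      then have "card (G a) \<le> 2 * card (F \<inter> G a)" using le pos by linarith
      also have "\<dots> \<le> \<gamma> * card (F \<inter> G a)" using \<gamma> by simp
      finally show ?thesis .
    qed
  qed
  have disj: "G a \<inter> G b = {}" if "a \<noteq> b" for a b
    using that inj unfolding G_def I_def inj_on_def by auto
  have "card ?S \<le> (\<Sum>a\<in>?X. card (G a))" unfolding S by (rule card_UN_le) simp
  also have "\<dots> \<le> (\<Sum>a\<in>?X. \<gamma> * card (F \<inter> G a))" using group by (rule sum_mono)
  also have "\<dots> = \<gamma> * (\<Sum>a\<in>?X. card (F \<inter> G a))" by (simp add: sum_distrib_left)
  also have "(\<Sum>a\<in>?X. card (F \<inter> G a)) = card (\<Union>a\<in>?X. F \<inter> G a)"
    using finG disj by (intro card_UN_disjoint[symmetric]) auto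
  also have "(\<Union>a\<in>?X. F \<inter> G a) = F \<inter> ?S" unfolding S by auto
  finally show ?thesis .
qed

text \<open>The fibres are disjoint and each selected one uses up at least \<gamma> of the
  \<open>n\<close> indices. This limits the extra queries spent on reasons.\<close>

lemma heavy_fibres:
  fixes x :: "nat \<Rightarrow> 'e"
  shows "\<gamma> * card {a \<in> x ` {..<n}. \<gamma> \<le> card {t. t < n \<and> x t = a}} \<le> n"
proof -
  let ?A = "{a \<in> x ` {..<n}. \<gamma> \<le> card {t. t < n \<and> x t = a}}"
  have "\<gamma> * card ?A = (\<Sum>a\<in>?A. \<gamma>)" by simp
  also have "\<dots> \<le> (\<Sum>a\<in>?A. card {t. t < n \<and> x t = a})" by (rule sum_mono) auto
  also have "\<dots> = card (\<Union>a\<in>?A. {t. t < n \<and> x t = a})"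
    by (intro card_UN_disjoint[symmetric]) auto
  also have "\<dots> \<le> card {..<n}" by (intro card_mono) auto
  finally show ?thesis by simp
qed

section \<open>Matchings from minimum vertex covers\<close>

text \<open>Hall's marriage theorem by the Halmos-Vaughan induction. A tight proper subset is
  matched first, and the rest avoids its neighbours. Without one, every proper subset has a
  neighbour to spare, so any single pair may be removed.\<close>

lemma hall:
  fixes N :: "'a \<Rightarrow> 'b set"
  assumes "finite A" "\<And>a. a \<in> A \<Longrightarrow> finite (N a)"
    and "\<And>S. S \<subseteq> A \<Longrightarrow> card S \<le> card (\<Union>a\<in>S. N a)"
  shows "\<exists>\<mu>. inj_on \<mu> A \<and> (\<forall>a\<in>A. \<mu> a \<in> N a)"
  using assms
proof (induction "card A" arbitrary: A N rule: less_induct)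
  case less
  note fin = less.prems(1,2) and hall = less.prems(3)
  have finN: "finite (\<Union>a\<in>S. N a)" if "S \<subseteq> A" for S
    using that fin finite_subset by blast
  show ?case
  proof (cases "\<exists>S. S \<subset> A \<and> S \<noteq> {} \<and> card S = card (\<Union>a\<in>S. N a)")
    case True
    then obtain S where S: "S \<subset> A" "S \<noteq> {}" "card S = card (\<Union>a\<in>S. N a)" by blast
    have finS: "finite S" using S fin finite_subset by blast
    have cS: "card S < card A" by (rule psubset_card_mono[OF fin(1) S(1)])
    have cD: "card (A - S) < card A" by (rule psubset_card_mono[OF fin(1)]) (use S in blast)
    obtain \<mu> where \<mu>: "inj_on \<mu> S" "\<forall>a\<in>S. \<mu> a \<in> N a"
      using less.hyps[OF cS finS fin(2) hall] S(1) by blast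
    define M where "M a = N a - (\<Union>a\<in>S. N a)" for a
    have hM: "card R \<le> card (\<Union>a\<in>R. M a)" if R: "R \<subseteq> A - S" for R
    proof -
      have "finite R" using R fin(1) by (meson finite_Diff finite_subset)
      then have "card S + card R = card (S \<union> R)"
        using R finS by (intro card_Un_disjoint[symmetric]) auto
      also have "\<dots> \<le> card (\<Union>a\<in>S \<union> R. N a)" using R S by (intro hall) auto
      also have "(\<Union>a\<in>S \<union> R. N a) = (\<Union>a\<in>S. N a) \<union> (\<Union>a\<in>R. M a)" unfolding M_def by auto
      also have "card \<dots> \<le> card (\<Union>a\<in>S. N a) + card (\<Union>a\<in>R. M a)" by (rule card_Un_le)
      finally show ?thesis using S(3) by simp
    qed
    have "\<exists>\<nu>. inj_on \<nu> (A - S) \<and> (\<forall>a\<in>A - S. \<nu> a \<in> M a)"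
      by (rule less.hyps[OF cD _ _ hM]) (use fin in \<open>auto simp: M_def\<close>)
    then obtain \<nu> where \<nu>: "inj_on \<nu> (A - S)" "\<forall>a\<in>A - S. \<nu> a \<in> M a" by blast
    let ?h = "\<lambda>a. if a \<in> S then \<mu> a else \<nu> a"
    have sep: "\<mu> a \<noteq> \<nu> b" if "a \<in> S" "b \<in> A - S" for a b
      using that \<mu>(2) \<nu>(2) unfolding M_def by fastforce
    have "inj_on ?h A"
      using \<mu>(1) \<nu>(1) sep unfolding inj_on_def by (metis DiffI)
    moreover have "\<forall>a\<in>A. ?h a \<in> N a" using \<mu>(2) \<nu>(2) unfolding M_def by auto
    ultimately show ?thesis by blast
  next
    case no_critical: False
    show ?thesis
    proof (cases "A = {}")
      case False
      then obtain a where a: "a \<in> A" by blast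
      have "card {a} \<le> card (\<Union>a\<in>{a}. N a)" using a by (intro hall) auto
      then have "N a \<noteq> {}" by auto
      then obtain b where b: "b \<in> N a" by blast
      have cA: "card (A - {a}) < card A" using a fin by (intro psubset_card_mono) auto
      have hM: "card R \<le> card (\<Union>c\<in>R. N c - {b})" if R: "R \<subseteq> A - {a}" for R
      proof (cases "R = {}")
        case False
        have "R \<subset> A" using R a by auto
        then have "card R < card (\<Union>c\<in>R. N c)"
          using False no_critical hall[of R] by (metis le_neq_implies_less psubset_imp_subset)
        moreover have "card (\<Union>c\<in>R. N c) \<le> Suc (card ((\<Union>c\<in>R. N c) - {b}))"
          using finN[of R] \<open>R \<subset> A\<close> by (cases "b \<in> (\<Union>c\<in>R. N c)") (auto simp: card_Diff_singleton_if)
        moreover have "(\<Union>c\<in>R. N c - {b}) = (\<Union>c\<in>R. N c) - {b}" by auto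
        ultimately show ?thesis by simp
      qed simp
      have "\<exists>\<nu>. inj_on \<nu> (A - {a}) \<and> (\<forall>c\<in>A - {a}. \<nu> c \<in> N c - {b})"
        by (rule less.hyps[OF cA _ _ hM]) (use fin in auto)
      then obtain \<nu> where \<nu>: "inj_on \<nu> (A - {a})" "\<forall>c\<in>A - {a}. \<nu> c \<in> N c - {b}" by blast
      have "inj_on (\<nu>(a := b)) A" using \<nu> unfolding inj_on_def by auto
      moreover have "\<forall>c\<in>A. (\<nu>(a := b)) c \<in> N c" using \<nu>(2) b by auto
      ultimately show ?thesis by blast
    qed simp
  qed
qed

definition covers :: "('a \<times> 'a) set \<Rightarrow> 'a set \<Rightarrow> bool" where
  "covers R V \<longleftrightarrow> (\<forall>(a, b)\<in>R. a \<in> V \<or> b \<in> V)"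

text \<open>Exchanging \<open>S\<close> for its neighbours outside \<open>V\<close> gives another
  cover, which cannot be smaller.\<close>

lemma min_cover_expansion:
  assumes R: "R \<subseteq> X \<times> Y" "X \<inter> Y = {}" "finite R"
    and V: "finite V" "covers R V" "\<And>V'. finite V' \<Longrightarrow> covers R V' \<Longrightarrow> card V \<le> card V'"
    and S: "S \<subseteq> V \<inter> X"
  shows "card S \<le> card (R `` S - V)"
proof -
  let ?N = "R `` S - V"
  have fin: "finite S" "finite ?N" using S V R(3) finite_subset by (auto intro: finite_Image)
  have "a \<in> V - S \<union> ?N \<or> b \<in> V - S \<union> ?N" if ab: "(a, b) \<in> R" for a b
  proof (cases "b \<in> V")
    case True
    moreover have "b \<notin> S" using ab R(1,2) S by blast
    ultimately show ?thesis by blast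
  next
    case False
    then have "a \<in> V" using V(2) ab unfolding covers_def by blast
    then show ?thesis using False ab by blast
  qed
  then have "covers R (V - S \<union> ?N)" unfolding covers_def by blast
  then have "card V \<le> card (V - S \<union> ?N)" using V(1) fin(2) by (intro V(3)) auto
  also have "\<dots> \<le> card (V - S) + card ?N" by (rule card_Un_le)
  also have "card (V - S) = card V - card S" using S fin by (intro card_Diff_subset) auto
  finally have "card V \<le> card V - card S + card ?N" by simp
  moreover have "card S \<le> card V" using S V(1) by (intro card_mono) auto
  ultimately show ?thesis by linarith
qed

text \<open>Both sides of a minimum cover expand, the second one by applying
  \<open>min_cover_expansion\<close> to the converse relation. Their outside neighbours lie on
  opposite sides, so the two counts add up and Hall's condition holds for all of \<open>V\<close> at
  once.\<close>

lemma min_cover_matching: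
  assumes R: "R \<subseteq> X \<times> Y" "X \<inter> Y = {}" "finite R"
  obtains V \<mu> where "finite V" "covers R V" "inj_on \<mu> V"
    "\<And>v. v \<in> V \<Longrightarrow> \<mu> v \<notin> V \<and> ((v, \<mu> v) \<in> R \<or> (\<mu> v, v) \<in> R)"
proof -
  let ?P = "\<lambda>V. finite V \<and> covers R V"
  have "?P (Field R)" using R finite_Field unfolding covers_def Field_def by auto
  then obtain V where V: "?P V" "\<And>V'. ?P V' \<Longrightarrow> card V \<le> card V'"
    using ex_has_least_nat[of ?P _ card] by metis
  define N where "N v = {u. u \<notin> V \<and> ((v, u) \<in> R \<or> (u, v) \<in> R)}" for v
  have finN: "finite (N v)" for v
    by (rule finite_subset[of _ "Field R"]) (use R finite_Field in \<open>auto simp: N_def Field_def\<close>)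
  have field: "V \<subseteq> X \<union> Y"
  proof
    fix v assume v: "v \<in> V"
    show "v \<in> X \<union> Y"
    proof (rule ccontr)
      assume "v \<notin> X \<union> Y"
      then have "covers R (V - {v})" using R V(1) unfolding covers_def by blast
      then have "card V \<le> card (V - {v})" using V by blast
      moreover have "card (V - {v}) < card V" using v V(1) by (intro psubset_card_mono) auto
      ultimately show False by simp
    qed
  qed
  have conv: "covers (R\<inverse>) W = covers R W" for W unfolding covers_def by auto
  have expansion: "card S \<le> card (\<Union>v\<in>S. N v)" if S: "S \<subseteq> V" for S
  proof -
    have finS: "finite S" using S V(1) finite_subset by blast
    have 1: "card (S \<inter> X) \<le> card (R `` (S \<inter> X) - V)"
      by (rule min_cover_expansion[OF R]) (use V S in auto)
    have 2: "card (S \<inter> Y) \<le> card (R\<inverse> `` (S \<inter> Y) - V)"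
      by (rule min_cover_expansion[of "R\<inverse>" Y X]) (use R V S in \<open>auto simp: conv\<close>)
    have "S = S \<inter> X \<union> S \<inter> Y" using S field by blast
    then have "card S = card (S \<inter> X \<union> S \<inter> Y)" by simp
    also have "\<dots> = card (S \<inter> X) + card (S \<inter> Y)"
      using finS R(2) by (intro card_Un_disjoint) auto
    also have "\<dots> \<le> card (R `` (S \<inter> X) - V) + card (R\<inverse> `` (S \<inter> Y) - V)" using 1 2 by linarith
    also have "\<dots> = card ((R `` (S \<inter> X) - V) \<union> (R\<inverse> `` (S \<inter> Y) - V))"
      using R finS by (intro card_Un_disjoint[symmetric]) (auto intro: finite_Image)
    also have "\<dots> \<le> card (\<Union>v\<in>S. N v)"
      using finS finN by (intro card_mono) (auto simp: N_def)
    finally show ?thesis .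
  qed
  have "finite V" using V(1) by blast
  then obtain \<mu> where "inj_on \<mu> V" "\<forall>v\<in>V. \<mu> v \<in> N v"
    using hall[OF _ finN expansion] by metis
  then show thesis using that[of V \<mu>] V(1) unfolding N_def by simp
qed

section \<open>Exchange systems\<close>

text \<open>The bases of a matroid, axiomatised by symmetric exchange.\<close>

locale base_system =
  fixes E :: "'e set" and base :: "'e set \<Rightarrow> bool"
  assumes finite_E: "finite E"
    and base_subset: "base T \<Longrightarrow> T \<subseteq> E"
    and base_ex: "\<exists>T. base T"
    and exchange: "\<lbrakk>base T; base T'; e \<in> T; e \<notin> T'\<rbrakk> \<Longrightarrow>
      \<exists>f. f \<in> T' \<and> f \<notin> T \<and> base (insert f (T - {e})) \<and> base (insert e (T' - {f}))"
begin

definition exch :: "'e set \<Rightarrow> 'e \<Rightarrow> 'e \<Rightarrow> bool" where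
  "exch T e f \<longleftrightarrow> base T \<and> e \<in> T \<and> f \<notin> T \<and> base (insert f (T - {e}))"

lemma exch_in_E: "exch T e f \<Longrightarrow> e \<in> E \<and> f \<in> E"
  using base_subset unfolding exch_def by blast

lemma base_finite: "base T \<Longrightarrow> finite T"
  using base_subset finite_E finite_subset by blast

lemma finite_bases: "finite {T. base T}"
  by (rule finite_subset[of _ "Pow E"]) (use base_subset finite_E in auto)

lemma base_exchange:
  assumes "base T" "base T'" "e \<in> T" "e \<notin> T'"
  obtains f where "exch T e f" "exch T' f e"
  using exchange[OF assms] assms unfolding exch_def by blast

lemma base_antichain:
  assumes "base T" "base T'" "T \<subseteq> T'"
  shows "T = T'"
  using exchange[OF assms(2,1)] assms by blast

lemma exch_sum:
  fixes k :: "'e \<Rightarrow> real"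
  assumes "exch T e f"
  shows "sum k (insert f (T - {e})) = sum k T - k e + k f"
  using assms base_finite unfolding exch_def by (simp add: sum_diff1)

text \<open>Move \<open>T'\<close> towards \<open>T\<close> one exchange at a time. By symmetry the
  reversed exchange is legal for \<open>T\<close>, so local minimality shows that no step raises the
  sum.\<close>

lemma locally_minimal_imp_minimal:
  fixes k :: "'e \<Rightarrow> real"
  assumes T: "base T" and loc: "\<And>e f. exch T e f \<Longrightarrow> k e \<le> k f" and "base T'"
  shows "sum k T \<le> sum k T'"
  using \<open>base T'\<close>
proof (induction "card (T - T')" arbitrary: T')
  case 0
  then show ?case
    using base_antichain[OF T] base_finite[OF T] by fastforce
next
  case (Suc n)
  then obtain e where e: "e \<in> T" "e \<notin> T'"
    by (metis card.empty DiffD1 DiffD2 all_not_in_conv nat.distinct(1))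
  obtain f where f: "exch T e f" "exch T' f e"
    using base_exchange[OF T Suc.prems e] .
  let ?S = "insert e (T' - {f})"
  have "base ?S" "f \<notin> T" using f unfolding exch_def by auto
  moreover have "T - ?S = T - T' - {e}" using \<open>f \<notin> T\<close> by auto
  then have "card (T - ?S) = n"
    using Suc.hyps(2) e base_finite[OF T] by (simp add: card_Diff_singleton)
  ultimately have "sum k T \<le> sum k ?S" using Suc.hyps(1) by blast
  then show ?case using exch_sum[OF f(2), of k] loc[OF f(1)] by simp
qed

lemma minimal_imp_locally_minimal:
  fixes k :: "'e \<Rightarrow> real"
  assumes "\<And>T'. base T' \<Longrightarrow> sum k T \<le> sum k T'" "exch T e f"
  shows "k e \<le> k f"
  using assms(1)[of "insert f (T - {e})"] exch_sum[OF assms(2), of k] assms(2)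
  unfolding exch_def by auto

end

section \<open>Uncertain weights\<close>

definition value_range :: "real \<Rightarrow> real \<Rightarrow> real set" where
  "value_range a b = (if a = b then {a} else {a<..<b})"

locale uncertain_bases = base_system E base
  for E :: "'e set" and base :: "'e set \<Rightarrow> bool" +
  fixes L U p :: "'e \<Rightarrow> real"
  assumes prediction_range: "e \<in> E \<Longrightarrow> p e \<in> value_range (L e) (U e)"
begin

definition adm :: "('e \<Rightarrow> real) \<Rightarrow> bool" where
  "adm w \<longleftrightarrow> (\<forall>e\<in>E. w e \<in> value_range (L e) (U e))"

definition lo :: "'e set \<Rightarrow> ('e \<Rightarrow> real) \<Rightarrow> 'e \<Rightarrow> real" where
  "lo Q w e = (if e \<in> Q then w e else L e)"

definition hi :: "'e set \<Rightarrow> ('e \<Rightarrow> real) \<Rightarrow> 'e \<Rightarrow> real" where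
  "hi Q w e = (if e \<in> Q then w e else U e)"

definition opn :: "'e set \<Rightarrow> 'e \<Rightarrow> bool" where
  "opn Q e \<longleftrightarrow> e \<in> E \<and> e \<notin> Q \<and> L e < U e"

text \<open>The exchange form of "\<open>T\<close> is minimal for all weights that are still
  possible"; \<open>feasible_iff\<close> proves the equivalence for spanning trees.\<close>

definition cert :: "'e set \<Rightarrow> ('e \<Rightarrow> real) \<Rightarrow> 'e set \<Rightarrow> bool" where
  "cert F w T \<longleftrightarrow> base T \<and> (\<forall>e f. exch T e f \<longrightarrow> hi F w e \<le> lo F w f)"

definition feas :: "'e set \<Rightarrow> ('e \<Rightarrow> real) \<Rightarrow> bool" where
  "feas F w \<longleftrightarrow> F \<subseteq> E \<and> (\<exists>T. cert F w T)"

text \<open>Ties are broken so that an open edge of a lower-minimal base, if not queried, lies in every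
  certified base; dually, an open edge outside an upper-minimal base lies in none.\<close>

definition Lopt :: "'e set \<Rightarrow> ('e \<Rightarrow> real) \<Rightarrow> 'e set \<Rightarrow> bool" where
  "Lopt Q w T \<longleftrightarrow> base T \<and> (\<forall>e f. exch T e f \<longrightarrow>
     lo Q w e < lo Q w f \<or> lo Q w e = lo Q w f \<and> (opn Q e \<longrightarrow> opn Q f))"

definition Uopt :: "'e set \<Rightarrow> ('e \<Rightarrow> real) \<Rightarrow> 'e set \<Rightarrow> bool" where
  "Uopt Q w T \<longleftrightarrow> base T \<and> (\<forall>e f. exch T e f \<longrightarrow>
     hi Q w e < hi Q w f \<or> hi Q w e = hi Q w f \<and> (opn Q f \<longrightarrow> opn Q e))"

lemma adm_prediction: "adm p"
  using prediction_range unfolding adm_def by blast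

lemma adm_bounds:
  assumes "adm w" "e \<in> E"
  shows "L e \<le> w e" "w e \<le> U e" "L e < U e \<Longrightarrow> L e < w e" "L e < U e \<Longrightarrow> w e < U e"
    "L e \<le> U e"
  using assms unfolding adm_def value_range_def by (auto split: if_splits dest!: bspec[where x=e])

lemma bounds_mono:
  assumes "adm w" "e \<in> E" "Q \<subseteq> F"
  shows "lo Q w e \<le> lo F w e" "lo F w e \<le> hi F w e" "hi F w e \<le> hi Q w e"
  using adm_bounds[OF assms(1,2)] assms(3) unfolding lo_def hi_def by auto

text \<open>The limits of an open edge can coincide under \<open>F\<close> only if \<open>F\<close>
  queries it. Its value is then strictly inside an open interval. All ties below are refuted by this
  strictness.\<close>

lemma pinned:
  assumes "adm w" "opn Q g" "Q \<subseteq> F" "lo F w g = hi F w g"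
  shows "lo Q w g < lo F w g" "hi F w g < hi Q w g"
  using adm_bounds[OF assms(1), of g] assms unfolding opn_def lo_def hi_def
  by (auto split: if_splits)

lemma not_opn: "adm w \<Longrightarrow> g \<in> E \<Longrightarrow> \<not> opn Q g \<Longrightarrow> lo Q w g = hi Q w g"
  using adm_bounds[of w g] unfolding opn_def lo_def hi_def by auto

lemma opn_less: "adm w \<Longrightarrow> g \<in> E \<Longrightarrow> lo Q w g < hi Q w g \<Longrightarrow> opn Q g"
  using not_opn[of w g Q] by auto

lemma opn_not_in: "opn Q e \<Longrightarrow> e \<notin> Q" "opn Q e \<Longrightarrow> e \<in> E"
  unfolding opn_def by auto

lemma lo_cong: "(\<And>e. e \<in> Q \<Longrightarrow> v e = w e) \<Longrightarrow> lo Q v = lo Q w"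
  unfolding lo_def by auto

lemma hi_cong: "(\<And>e. e \<in> Q \<Longrightarrow> v e = w e) \<Longrightarrow> hi Q v = hi Q w"
  unfolding hi_def by auto

lemma feas_cong: "(\<And>e. e \<in> Q \<Longrightarrow> v e = w e) \<Longrightarrow> feas Q v = feas Q w"
  using lo_cong[of Q v w] hi_cong[of Q v w] unfolding feas_def cert_def by simp

lemma Lopt_cong: "(\<And>e. e \<in> Q \<Longrightarrow> v e = w e) \<Longrightarrow> Lopt Q v = Lopt Q w"
  using lo_cong[of Q v w] unfolding Lopt_def by (intro ext) simp

lemma Uopt_cong: "(\<And>e. e \<in> Q \<Longrightarrow> v e = w e) \<Longrightarrow> Uopt Q v = Uopt Q w"
  using hi_cong[of Q v w] unfolding Uopt_def by (intro ext) simp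

lemma cert_mono:
  assumes "adm w" "Q \<subseteq> F" "cert Q w T"
  shows "cert F w T"
  unfolding cert_def
proof (intro conjI allI impI)
  show "base T" using assms(3) unfolding cert_def by blast
  fix e f assume ef: "exch T e f"
  then have "hi Q w e \<le> lo Q w f" using assms(3) unfolding cert_def by blast
  then show "hi F w e \<le> lo F w f"
    using bounds_mono[OF assms(1) _ assms(2)] exch_in_E[OF ef] by (meson order_trans)
qed

lemma feas_mono: "adm w \<Longrightarrow> Q \<subseteq> F \<Longrightarrow> F \<subseteq> E \<Longrightarrow> feas Q w \<Longrightarrow> feas F w"
  unfolding feas_def using cert_mono by blast

text \<open>Otherwise exchange \<open>e\<close> for some \<open>f\<close> of \<open>T'\<close>.
  Certification and lower-minimality squeeze both limits of \<open>f\<close> under \<open>F\<close>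
  onto \<open>lo Q w e\<close>, so \<open>f\<close> is open for \<open>Q\<close> yet fixed at its
  lower limit, against \<open>pinned\<close>.\<close>

lemma open_in_certified:
  assumes w: "adm w" and Q: "Q \<subseteq> F" and T: "Lopt Q w T" and T': "cert F w T'"
    and e: "e \<in> T" "opn Q e" "e \<notin> F"
  shows "e \<in> T'"
proof (rule ccontr)
  assume "e \<notin> T'"
  moreover have "base T" "base T'" using T T' unfolding Lopt_def cert_def by auto
  ultimately obtain f where f: "exch T e f" "exch T' f e"
    using e(1) base_exchange by metis
  have fE: "f \<in> E" and eE: "e \<in> E" using exch_in_E[OF f(1)] by auto
  have 1: "hi F w f \<le> lo F w e" using T' f(2) unfolding cert_def by blast
  have 2: "lo F w e = lo Q w e" using e(3) Q unfolding lo_def by auto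
  have 3: "lo Q w e < lo Q w f \<or> lo Q w e = lo Q w f \<and> opn Q f"
    using T f(1) e(2) unfolding Lopt_def by blast
  note b = bounds_mono[OF w fE Q]
  have "lo Q w e = lo Q w f" "opn Q f" "lo F w f = hi F w f" "lo F w f = lo Q w f"
    using 1 2 3 b by linarith+
  then show False using pinned[OF w _ Q] by force
qed

lemma open_notin_certified:
  assumes w: "adm w" and Q: "Q \<subseteq> F" and T: "Uopt Q w T" and T': "cert F w T'"
    and e: "e \<notin> T" "opn Q e" "e \<notin> F"
  shows "e \<notin> T'"
proof
  assume "e \<in> T'"
  moreover have "base T" "base T'" using T T' unfolding Uopt_def cert_def by auto
  ultimately obtain f where f: "exch T' e f" "exch T f e"
    using e(1) base_exchange by metis
  have fE: "f \<in> E" and eE: "e \<in> E" using exch_in_E[OF f(1)] by auto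
  have 1: "hi F w e \<le> lo F w f" using T' f(1) unfolding cert_def by blast
  have 2: "hi F w e = hi Q w e" using e(3) Q unfolding hi_def by auto
  have 3: "hi Q w f < hi Q w e \<or> hi Q w f = hi Q w e \<and> opn Q f"
    using T f(2) e(2) unfolding Uopt_def by blast
  note b = bounds_mono[OF w fE Q]
  have "hi Q w e = hi Q w f" "opn Q f" "lo F w f = hi F w f" "hi F w f = hi Q w f"
    using 1 2 3 b by linarith+
  then show False using pinned[OF w _ Q] by force
qed

text \<open>If \<open>e\<close> is not queried it lies in the certified base \<open>T'\<close>. Exchanging it between \<open>T'\<close> and
  \<open>T - e + f\<close> yields either \<open>f\<close> itself or a tree edge \<open>g\<close> contradicting the maximality of \<open>e\<close>.\<close>

lemma witness_hi:
  assumes w: "adm w" and QE: "Q \<subseteq> E" and T: "Lopt Q w T" and ef: "exch T e f"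
    and less: "lo Q w f < hi Q w e" and mx: "\<And>e'. exch T e' f \<Longrightarrow> hi Q w e' \<le> hi Q w e"
    and F: "feas F w"
  shows "opn Q e" and "e \<in> F \<or> f \<in> F \<union> Q \<and> hi Q w e \<le> w f"
proof -
  have E: "e \<in> E" "f \<in> E" using exch_in_E[OF ef] by auto
  have "lo Q w e \<le> lo Q w f" using T ef unfolding Lopt_def by force
  then show oe: "opn Q e" using less opn_less[OF w E(1)] by simp
  show "e \<in> F \<or> f \<in> F \<union> Q \<and> hi Q w e \<le> w f"
  proof (rule ccontr)
    assume neg: "\<not> ?thesis"
    let ?F = "F \<union> Q"
    have "feas ?F w" using feas_mono[OF w _ _ F] F QE unfolding feas_def by blast
    then obtain T' where T': "cert ?F w T'" unfolding feas_def by blast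
    have eF: "e \<notin> ?F" using neg oe unfolding opn_def by auto
    have eT: "e \<in> T" using ef unfolding exch_def by blast
    have eT': "e \<in> T'" using open_in_certified[OF w _ T T' eT oe eF] by blast
    define T1 where "T1 = insert f (T - {e})"
    have "base T1" "e \<notin> T1" "base T'"
      using ef T' unfolding T1_def exch_def cert_def by auto
    then obtain g where g: "exch T' e g" "exch T1 g e"
      using base_exchange[of T' T1 e] eT' by metis
    have ge: "hi Q w e \<le> lo ?F w g"
      proof -
      have "hi ?F w e \<le> lo ?F w g" using T' g(1) unfolding cert_def by blast
      then show ?thesis using eF unfolding hi_def by simp
    qed
    show False
    proof (cases "g = f")
      case True
      then show False using ge neg less unfolding lo_def by (auto split: if_splits)
    next
      case False
      have gT: "g \<in> T" "g \<noteq> e" using g(2) False unfolding T1_def exch_def by auto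
      \<comment> \<open>Undoing the second exchange shows that \<open>g\<close> too is exchangeable
        for \<open>f\<close> in \<open>T\<close>, so the maximality of \<open>e\<close> applies to
        \<open>g\<close>.\<close>
      have "insert e (T1 - {g}) = insert f (T - {g})"
        using False gT eT unfolding T1_def by auto
      then have gf: "exch T g f" using g(2) ef gT unfolding exch_def by auto
      have gE: "g \<in> E" using exch_in_E[OF gf] by auto
      have 1: "hi Q w g \<le> hi Q w e" using mx[OF gf] .
      have 2: "lo Q w g \<le> lo Q w f" using T gf unfolding Lopt_def by force
      note b = bounds_mono[OF w gE, of Q ?F]
      have "opn Q g" using opn_less[OF w gE] ge 1 2 less b by auto
      moreover have "lo ?F w g = hi ?F w g" "hi ?F w g = hi Q w g" using ge 1 b by auto
      ultimately show False using pinned[OF w, of Q g ?F] by auto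
    qed
  qed
qed

text \<open>The dual of \<open>witness_hi\<close>: an unqueried \<open>f\<close> lies outside the
  certified base, and exchanging it between \<open>T - e + f\<close> and that base yields either
  \<open>e\<close> or a non-tree edge that contradicts the choice of \<open>f\<close> as
  lowest.\<close>

lemma witness_lo:
  assumes w: "adm w" and QE: "Q \<subseteq> E" and T: "Uopt Q w T" and ef: "exch T e f"
    and less: "lo Q w f < hi Q w e" and mn: "\<And>f'. exch T e f' \<Longrightarrow> lo Q w f \<le> lo Q w f'"
    and F: "feas F w"
  shows "opn Q f" and "f \<in> F \<or> e \<in> F \<union> Q \<and> w e \<le> lo Q w f"
proof -
  have E: "e \<in> E" "f \<in> E" using exch_in_E[OF ef] by auto
  have "hi Q w e \<le> hi Q w f" using T ef unfolding Uopt_def by force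
  then show ofn: "opn Q f" using less opn_less[OF w E(2)] by simp
  show "f \<in> F \<or> e \<in> F \<union> Q \<and> w e \<le> lo Q w f"
  proof (rule ccontr)
    assume neg: "\<not> ?thesis"
    let ?F = "F \<union> Q"
    have "feas ?F w" using feas_mono[OF w _ _ F] F QE unfolding feas_def by blast
    then obtain T' where T': "cert ?F w T'" unfolding feas_def by blast
    have fF: "f \<notin> ?F" using neg ofn unfolding opn_def by auto
    have fT: "f \<notin> T" "e \<in> T" using ef unfolding exch_def by blast+
    have fT': "f \<notin> T'" using open_notin_certified[OF w _ T T' fT(1) ofn fF] by blast
    define T1 where "T1 = insert f (T - {e})"
    have "base T1" "f \<in> T1" "base T'"
      using ef T' unfolding T1_def exch_def cert_def by auto
    then obtain g where g: "exch T1 f g" "exch T' g f"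
      using base_exchange[of T1 T' f] fT' by metis
    have ge: "hi ?F w g \<le> lo Q w f"
      proof -
      have "hi ?F w g \<le> lo ?F w f" using T' g(2) unfolding cert_def by blast
      then show ?thesis using fF unfolding lo_def by simp
    qed
    show False
    proof (cases "g = e")
      case True
      then show False using ge neg less unfolding hi_def by (auto split: if_splits)
    next
      case False
      have gT: "g \<notin> T" "g \<noteq> f" using g(1) False unfolding T1_def exch_def by auto
      have "insert g (T1 - {f}) = insert g (T - {e})"
        using fT unfolding T1_def by auto
      then have eg: "exch T e g" using g(1) ef gT unfolding exch_def by auto
      have gE: "g \<in> E" using exch_in_E[OF eg] by auto
      have 1: "lo Q w f \<le> lo Q w g" using mn[OF eg] .
      have 2: "hi Q w e \<le> hi Q w g" using T eg unfolding Uopt_def by force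
      note b = bounds_mono[OF w gE, of Q ?F]
      have "opn Q g" using opn_less[OF w gE] ge 1 2 less b by auto
      moreover have "lo ?F w g = hi ?F w g" "lo ?F w g = lo Q w g" using ge 1 b by auto
      ultimately show False using pinned[OF w, of Q g ?F] by auto
    qed
  qed
qed

text \<open>Ranks turn strict inequalities of reals into gaps of at least 1. Doubled, they leave
  room for a tie-breaking term of 1 in the keys.\<close>

definition rank :: "('e \<Rightarrow> real) \<Rightarrow> 'e \<Rightarrow> nat" where
  "rank k e = card {g \<in> E. k g < k e}"

lemma rank_less: "e \<in> E \<Longrightarrow> k e < k f \<Longrightarrow> rank k e < rank k f"
  unfolding rank_def using finite_E by (intro psubset_card_mono) auto

lemma rank_eq: "k e = k f \<Longrightarrow> rank k e = rank k f"
  unfolding rank_def by simp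

text \<open>Real-valued keys inducing the lexicographic orders of \<open>Lopt\<close> and \<open>Uopt\<close>, so that minimal bases
  exist by minimising a sum.\<close>

definition lo_key :: "'e set \<Rightarrow> ('e \<Rightarrow> real) \<Rightarrow> 'e \<Rightarrow> real" where
  "lo_key Q w e = 2 * real (rank (lo Q w) e) + (if opn Q e then 1 else 0)"

definition hi_key :: "'e set \<Rightarrow> ('e \<Rightarrow> real) \<Rightarrow> 'e \<Rightarrow> real" where
  "hi_key Q w e = 2 * real (rank (hi Q w) e) - (if opn Q e then 1 else 0)"

definition min_base :: "('e \<Rightarrow> real) \<Rightarrow> 'e set \<Rightarrow> bool" where
  "min_base k T \<longleftrightarrow> base T \<and> (\<forall>T'. base T' \<longrightarrow> sum k T \<le> sum k T')"

lemma min_base_ex: "\<exists>T. min_base k T"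
proof -
  obtain T where "T \<in> {T. base T}" "\<forall>T'\<in>{T. base T}. \<not> sum k T' < sum k T"
    using finite_has_minimal[of "sum k ` {T. base T}"] finite_bases base_ex by fastforce
  then show ?thesis unfolding min_base_def by force
qed

lemma min_base_Lopt:
  assumes "min_base (lo_key Q w) T"
  shows "Lopt Q w T"
  unfolding Lopt_def
proof (intro conjI allI impI)
  show "base T" using assms unfolding min_base_def by blast
  fix e f assume ef: "exch T e f"
  have *: "lo_key Q w e \<le> lo_key Q w f"
    using minimal_imp_locally_minimal[OF _ ef, of "lo_key Q w"] assms
    unfolding min_base_def by blast
  show "lo Q w e < lo Q w f \<or> lo Q w e = lo Q w f \<and> (opn Q e \<longrightarrow> opn Q f)"
  proof (cases "lo Q w e" "lo Q w f" rule: linorder_cases)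
    case equal
    then show ?thesis using * rank_eq[OF equal] unfolding lo_key_def by (auto split: if_splits)
  next
    case greater
    then show ?thesis using * rank_less[of f "lo Q w" e] exch_in_E[OF ef] unfolding lo_key_def
      by (auto split: if_splits)
  qed simp
qed

lemma min_base_Uopt:
  assumes "min_base (hi_key Q w) T"
  shows "Uopt Q w T"
  unfolding Uopt_def
proof (intro conjI allI impI)
  show "base T" using assms unfolding min_base_def by blast
  fix e f assume ef: "exch T e f"
  have *: "hi_key Q w e \<le> hi_key Q w f"
    using minimal_imp_locally_minimal[OF _ ef, of "hi_key Q w"] assms
    unfolding min_base_def by blast
  show "hi Q w e < hi Q w f \<or> hi Q w e = hi Q w f \<and> (opn Q f \<longrightarrow> opn Q e)"
  proof (cases "hi Q w e" "hi Q w f" rule: linorder_cases)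
    case equal
    then show ?thesis using * rank_eq[OF equal] unfolding hi_key_def by (auto split: if_splits)
  next
    case greater
    then show ?thesis using * rank_less[of f "hi Q w" e] exch_in_E[OF ef] unfolding hi_key_def
      by (auto split: if_splits)
  qed simp
qed

lemma min_base_swap:
  assumes "min_base k T" "exch T e f" "k e = k f"
  shows "min_base k (insert f (T - {e}))"
  using assms exch_sum[OF assms(2), of k] unfolding min_base_def exch_def by auto

text \<open>Take a lower-minimal and an upper-minimal base with largest intersection. If they differ, an
  edge of their difference is open, and unless queried it would have to lie both inside and outside
  every certified base.\<close>

lemma common_base_or_mandatory:
  assumes v: "adm v" and Q: "Q \<subseteq> E"
  obtains T where "Lopt Q v T" "Uopt Q v T"
  | e where "opn Q e" "\<And>w F. adm w \<Longrightarrow> (\<And>e. e \<in> Q \<Longrightarrow> v e = w e) \<Longrightarrow> feas F w \<Longrightarrow> e \<in> F"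
proof -
  let ?P = "\<lambda>X. min_base (lo_key Q v) (fst X) \<and> min_base (hi_key Q v) (snd X)"
  obtain X0 where "?P X0"
    using min_base_ex[of "lo_key Q v"] min_base_ex[of "hi_key Q v"] by auto
  moreover have "\<forall>X. ?P X \<longrightarrow> card (fst X \<inter> snd X) < Suc (card E)"
    unfolding min_base_def using base_subset finite_E
    by (meson card_mono le_infI1 le_imp_less_Suc)
  ultimately obtain X where X: "?P X" "\<And>Y. ?P Y \<Longrightarrow> card (fst Y \<inter> snd Y) \<le> card (fst X \<inter> snd X)"
    using ex_has_greatest_nat[of ?P X0 "\<lambda>X. card (fst X \<inter> snd X)" "Suc (card E)"] by metis
  define T S where "T = fst X" and "S = snd X"
  have T: "Lopt Q v T" and S: "Uopt Q v S"
    using X(1) min_base_Lopt min_base_Uopt unfolding T_def S_def by auto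
  have b: "base T" "base S" using T S unfolding Lopt_def Uopt_def by auto
  show thesis
  proof (cases "T = S")
    case True
    then show thesis using T S that(1) by blast
  next
    case False
    then obtain e where e: "e \<in> T" "e \<notin> S" using base_antichain[OF b] by blast
    have "opn Q e"
    proof (rule ccontr)
      assume ne: "\<not> opn Q e"
      \<comment> \<open>If \<open>e\<close> is not open, the two minimality conditions force
        \<open>f\<close> to have the same single value. Exchanging \<open>e\<close> for
        \<open>f\<close> then keeps \<open>T\<close> minimal and enlarges the intersection.\<close>
      obtain f where f: "exch T e f" "exch S f e" using base_exchange[OF b e] .
      have E: "e \<in> E" "f \<in> E" using exch_in_E[OF f(1)] by auto
      have 1: "lo Q v e \<le> lo Q v f" "hi Q v f \<le> hi Q v e"
        using T S f unfolding Lopt_def Uopt_def by force+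
      have 2: "lo Q v e = hi Q v e" using not_opn[OF v E(1) ne] .
      have 3: "lo Q v f \<le> hi Q v f" using bounds_mono[OF v E(2), of Q Q] by simp
      have "\<not> opn Q f"
        using 1 2 adm_bounds[OF v E(2)] unfolding opn_def lo_def hi_def by (auto split: if_splits)
      then have "lo_key Q v e = lo_key Q v f"
        using ne rank_eq[of "lo Q v" e f] 1 2 3 unfolding lo_key_def by simp
      then have "?P (insert f (T - {e}), S)"
        using X(1) min_base_swap f(1) unfolding T_def S_def by auto
      then have "card (insert f (T - {e}) \<inter> S) \<le> card (T \<inter> S)"
        using X(2) unfolding T_def S_def by fastforce
      moreover have "insert f (T - {e}) \<inter> S = insert f (T \<inter> S)" "f \<notin> T"
        using e f unfolding exch_def by auto
      ultimately show False using base_finite[OF b(1)] by simp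
    qed
    moreover have "e \<in> F" if w: "adm w" "\<And>e. e \<in> Q \<Longrightarrow> v e = w e" "feas F w" for w F
    proof (rule ccontr)
      assume "e \<notin> F"
      then have eF: "e \<notin> F \<union> Q" using \<open>opn Q e\<close> unfolding opn_def by auto
      have "feas (F \<union> Q) w" using feas_mono[OF w(1) _ _ w(3)] w(3) Q unfolding feas_def by blast
      then obtain T' where T': "cert (F \<union> Q) w T'" unfolding feas_def by blast
      have "Lopt Q w T" "Uopt Q w S" using T S Lopt_cong[OF w(2)] Uopt_cong[OF w(2)] by auto
      then show False
        using open_in_certified[OF w(1) _ _ T' e(1) \<open>opn Q e\<close> eF]
          open_notin_certified[OF w(1) _ _ T' e(2) \<open>opn Q e\<close> eF] by blast
    qed
    ultimately show thesis using that(2) by blast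
  qed
qed

text \<open>\<open>v\<close> records the answers on \<open>Q\<close>, and \<open>w\<close> is a
  truth compatible with them. A strategy cannot tell such \<open>w\<close> apart, so its guarantees
  are quantified over all of them.\<close>

definition agree :: "'e set \<Rightarrow> ('e \<Rightarrow> real) \<Rightarrow> ('e \<Rightarrow> real) \<Rightarrow> bool" where
  "agree Q v w \<longleftrightarrow> adm w \<and> (\<forall>e\<in>Q. v e = w e)"

lemma agree_mono: "agree Q v w \<Longrightarrow> R \<subseteq> Q \<Longrightarrow> agree R v w"
  unfolding agree_def by blast

lemma agree_congs:
  assumes "agree Q v w"
  shows "Lopt Q v = Lopt Q w" "Uopt Q v = Uopt Q w" "lo Q v = lo Q w" "hi Q v = hi Q w"
    "feas Q v = feas Q w"
proof -
  have *: "\<And>e. e \<in> Q \<Longrightarrow> v e = w e" using assms unfolding agree_def by blast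
  show "Lopt Q v = Lopt Q w" by (rule Lopt_cong[OF *])
  show "Uopt Q v = Uopt Q w" by (rule Uopt_cong[OF *])
  show "lo Q v = lo Q w" by (rule lo_cong[OF *])
  show "hi Q v = hi Q w" by (rule hi_cong[OF *])
  show "feas Q v = feas Q w" by (rule feas_cong[OF *])
qed

text \<open>Since \<open>T\<close> is minimal for both limits, an overlap makes both edges open, and
  the alternative \<open>f \<in> F \<union> Q\<close> of \<open>witness_hi\<close> shrinks to
  \<open>f \<in> F\<close>. Thus \<open>{e, f}\<close> is a witness pair, and \<open>e\<close> is
  mandatory once \<open>w f\<close> is known to be below its upper limit.\<close>

lemma agree_witness_hi:
  assumes v: "adm v" and QE: "Q \<subseteq> E" and T: "Lopt Q v T" "Uopt Q v T" and ef: "exch T e f"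
    and less: "lo Q v f < hi Q v e" and mx: "\<And>e'. exch T e' f \<Longrightarrow> hi Q v e' \<le> hi Q v e"
  shows "opn Q e" "opn Q f"
    "agree Q v w \<Longrightarrow> feas F w \<Longrightarrow> e \<in> F \<or> f \<in> F \<and> hi Q v e \<le> w f"
proof -
  have E: "e \<in> E" "f \<in> E" using exch_in_E[OF ef] by auto
  have "lo Q v e \<le> lo Q v f" "hi Q v e \<le> hi Q v f"
    using T ef unfolding Lopt_def Uopt_def by force+
  then show *: "opn Q e" "opn Q f" using less opn_less[OF v] E by auto
  assume w: "agree Q v w" "feas F w"
  note c = agree_congs[OF w(1)]
  show "e \<in> F \<or> f \<in> F \<and> hi Q v e \<le> w f"
    using witness_hi(2)[OF _ QE T(1)[unfolded c] ef less[unfolded c] mx[unfolded c] w(2)] w(1) *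
    unfolding c agree_def opn_def by blast
qed

lemma agree_witness_lo:
  assumes v: "adm v" and QE: "Q \<subseteq> E" and T: "Lopt Q v T" "Uopt Q v T" and ef: "exch T e f"
    and less: "lo Q v f < hi Q v e" and mn: "\<And>f'. exch T e f' \<Longrightarrow> lo Q v f \<le> lo Q v f'"
  shows "opn Q e" "opn Q f"
    "agree Q v w \<Longrightarrow> feas F w \<Longrightarrow> f \<in> F \<or> e \<in> F \<and> w e \<le> lo Q v f"
proof -
  have E: "e \<in> E" "f \<in> E" using exch_in_E[OF ef] by auto
  have "lo Q v e \<le> lo Q v f" "hi Q v e \<le> hi Q v f"
    using T ef unfolding Lopt_def Uopt_def by force+
  then show *: "opn Q e" "opn Q f" using less opn_less[OF v] E by auto
  assume w: "agree Q v w" "feas F w"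
  note c = agree_congs[OF w(1)]
  show "f \<in> F \<or> e \<in> F \<and> w e \<le> lo Q v f"
    using witness_lo(2)[OF _ QE T(2)[unfolded c] ef less[unfolded c] mn[unfolded c] w(2)] w(1) *
    unfolding c agree_def opn_def by blast
qed

lemma max_hi:
  assumes "exch T e f"
  obtains e' where "exch T e' f" "\<And>e''. exch T e'' f \<Longrightarrow> hi Q w e'' \<le> hi Q w e'"
proof -
  have "finite {e. exch T e f}" using exch_in_E finite_E by (blast intro: finite_subset[of _ E])
  then have "finite (hi Q w ` {e. exch T e f})" by blast
  moreover have "hi Q w ` {e. exch T e f} \<noteq> {}" using assms by auto
  ultimately have "Max (hi Q w ` {e. exch T e f}) \<in> hi Q w ` {e. exch T e f}"
    and "\<And>e''. exch T e'' f \<Longrightarrow> hi Q w e'' \<le> Max (hi Q w ` {e. exch T e f})"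
    using Max_in Max_ge by blast+
  then show thesis using that by auto
qed

lemma min_lo:
  assumes "exch T e f"
  obtains f' where "exch T e f'" "\<And>f''. exch T e f'' \<Longrightarrow> lo Q w f' \<le> lo Q w f''"
proof -
  have "finite {f. exch T e f}" using exch_in_E finite_E by (blast intro: finite_subset[of _ E])
  then have "finite (lo Q w ` {f. exch T e f})" by blast
  moreover have "lo Q w ` {f. exch T e f} \<noteq> {}" using assms by auto
  ultimately have "Min (lo Q w ` {f. exch T e f}) \<in> lo Q w ` {f. exch T e f}"
    and "\<And>f''. exch T e f'' \<Longrightarrow> Min (lo Q w ` {f. exch T e f}) \<le> lo Q w f''"
    using Min_in Min_le by blast+
  then show thesis using that by auto
qed

text \<open>These are the queries of the 2-competitive strategy: a witness pair from a violated
  exchange of a common base, or else one mandatory edge.\<close>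

lemma witness_set_ex:
  assumes v: "adm v" and QE: "Q \<subseteq> E" and nf: "\<not> feas Q v"
  obtains W where "W \<subseteq> E" "W \<inter> Q = {}" "W \<noteq> {}" "card W \<le> 2"
    "\<And>w F. agree Q v w \<Longrightarrow> feas F w \<Longrightarrow> F \<inter> W \<noteq> {}"
  using common_base_or_mandatory[OF v QE]
proof cases
  case (1 T)
  then have "base T" unfolding Lopt_def by blast
  then obtain e f where ef: "exch T e f" "lo Q v f < hi Q v e"
    using nf QE unfolding feas_def cert_def by (meson not_le)
  obtain e' where e': "exch T e' f" "\<And>e''. exch T e'' f \<Longrightarrow> hi Q v e'' \<le> hi Q v e'"
    using max_hi[OF ef(1)] by blast
  have "lo Q v f < hi Q v e'" using ef e'(2)[OF ef(1)] by linarith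
  note W = agree_witness_hi[OF v QE 1 e'(1) this e'(2)]
  show thesis
    by (rule that[of "{e', f}"]) (use W opn_not_in in \<open>auto simp: card_insert_if\<close>)
next
  case (2 e)
  show thesis
    by (rule that[of "{e}"]) (use 2 opn_not_in in \<open>auto simp: agree_def\<close>)
qed

end

section \<open>The query game\<close>

locale query_game = uncertain_bases E base L U p
  for E :: "'e set" and base :: "'e set \<Rightarrow> bool" and L U p :: "'e \<Rightarrow> real" +
  fixes \<gamma> :: nat
  assumes \<gamma>_ge: "2 \<le> \<gamma>"
begin

text \<open>The comparison is with every feasible set, in particular with an optimal one. The
  consistency bound is multiplied by \<gamma> so that it stays within the naturals.\<close>

definition good :: "('e \<Rightarrow> real) \<Rightarrow> 'e set \<Rightarrow> bool" where
  "good w Q \<longleftrightarrow> (\<forall>F. feas F w \<longrightarrow> card Q \<le> \<gamma> * card F \<and>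
     ((\<forall>e\<in>E. w e = p e) \<longrightarrow> \<gamma> * card Q \<le> (\<gamma> + 1) * card F))"

text \<open>\<open>win Q v\<close>: from the state where \<open>Q\<close> has been queried with results \<open>v\<close>, some continuation
  meets both bounds. The values of \<open>v\<close> outside \<open>Q\<close> are irrelevant.\<close>

inductive win :: "'e set \<Rightarrow> ('e \<Rightarrow> real) \<Rightarrow> bool" where
  win_stop: "feas Q v \<Longrightarrow> (\<And>w. agree Q v w \<Longrightarrow> good w Q) \<Longrightarrow> win Q v"
| win_query: "e \<in> E \<Longrightarrow> e \<notin> Q \<Longrightarrow>
    (\<And>y. y \<in> value_range (L e) (U e) \<Longrightarrow> win (insert e Q) (v(e := y))) \<Longrightarrow> win Q v"

text \<open>Lets a strategy ask for an edge without distinguishing whether its value is already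
  known.\<close>

lemma win_query_known:
  assumes v: "adm v" and e: "e \<in> E"
    and win: "\<And>v'. adm v' \<Longrightarrow> (\<And>a. a \<in> Q \<Longrightarrow> v' a = v a) \<Longrightarrow> win (insert e Q) v'"
  shows "win Q v"
proof (cases "e \<in> Q")
  case True
  then show ?thesis using win[OF v] by (simp add: insert_absorb)
next
  case False
  show ?thesis
  proof (rule win_query[OF e False])
    fix y assume "y \<in> value_range (L e) (U e)"
    then have "adm (v(e := y))" using v unfolding adm_def by auto
    then show "win (insert e Q) (v(e := y))" by (rule win) (use False in auto)
  qed
qed

text \<open>\<open>good\<close> is inherited by smaller query sets, so the guarantee at the end of
  the strategy holds at each intermediate state. This matters because a run stops at the first
  feasible set, possibly before the strategy is finished.\<close>

lemma good_win:
  assumes "win Q v" "agree Q v w" "Q \<subseteq> E"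
  shows "good w Q"
  using assms
proof (induction rule: win.induct)
  case (win_query e Q v)
  note IH = win_query.IH and ag = win_query.prems(1) and QE = win_query.prems(2)
  have we: "w e \<in> value_range (L e) (U e)" using ag win_query.hyps(1) unfolding agree_def adm_def by blast
  have "agree (insert e Q) (v(e := w e)) w" using ag unfolding agree_def by auto
  then have *: "good w (insert e Q)" using IH[OF we] win_query.hyps(1) QE by blast
  have "card Q \<le> card (insert e Q)"
    using QE finite_E finite_subset by (intro card_mono) auto
  then have "card Q \<le> card (insert e Q)" "\<gamma> * card Q \<le> \<gamma> * card (insert e Q)"
    by (simp_all del: card_insert_disjoint)
  then show ?case using * unfolding good_def by (meson le_trans)
qed blast

text \<open>\<open>R\<close> collects the edges that have already been paid for. Once a prediction is known to be wrong,
  only robustness matters, and querying witness pairs costs a factor of two.\<close>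

lemma win_after_error:
  assumes "adm v" "Q \<subseteq> E" "R \<subseteq> E" "a \<in> Q" "v a \<noteq> p a"
    and "\<And>w F. agree Q v w \<Longrightarrow> feas F w \<Longrightarrow> card (Q \<union> R) \<le> \<gamma> * card (F \<inter> (Q \<union> R))"
  shows "win Q v"
  using assms
proof (induction "card (E - Q)" arbitrary: Q R v rule: less_induct)
  case less
  note v = less.prems(1) and QE = less.prems(2) and err = less.prems(4,5)
  have finQ: "finite Q" using QE finite_E finite_subset by blast
  \<comment> \<open>Querying an edge of \<open>S\<close> leaves \<open>Q \<union> S\<close>
    unchanged, so the bound persists with \<open>S\<close> in the role of \<open>R\<close>.\<close>
  have query: "win Q v"
    if e: "e \<in> S" "e \<notin> Q" and SE: "S \<subseteq> E"
      and S: "\<And>w F. agree Q v w \<Longrightarrow> feas F w \<Longrightarrow> card (Q \<union> S) \<le> \<gamma> * card (F \<inter> (Q \<union> S))" for e S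
  proof (rule win_query)
    show eE: "e \<in> E" and "e \<notin> Q" using e SE by auto
    fix y assume y: "y \<in> value_range (L e) (U e)"
    have un: "insert e Q \<union> S = Q \<union> S" using e by auto
    show "win (insert e Q) (v(e := y))"
    proof (rule less.hyps[of _ _ S])
      show "card (E - insert e Q) < card (E - Q)"
        using finite_E e eE by (intro psubset_card_mono) auto
      show "adm (v(e := y))" using v y unfolding adm_def by auto
      show "insert e Q \<subseteq> E" "S \<subseteq> E" "a \<in> insert e Q" "(v(e := y)) a \<noteq> p a"
        using QE eE SE err e by auto
      fix w F assume "agree (insert e Q) (v(e := y)) w" "feas F w"
      moreover have "(v(e := y)) b = v b" if "b \<in> Q" for b using that e by auto
      ultimately have "agree Q v w" unfolding agree_def by (metis insertCI)
      then show "card (insert e Q \<union> S) \<le> \<gamma> * card (F \<inter> (insert e Q \<union> S))"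
        unfolding un using S \<open>feas F w\<close> by blast
    qed
  qed
  show ?case
  proof (cases "R \<subseteq> Q")
    case False
    then show ?thesis using query[of _ R] less.prems(3,6) by (metis subsetI)
  next
    case True
    then have R: "Q \<union> R = Q" by auto
    show ?thesis
    proof (cases "feas Q v")
      case True
      show ?thesis
      proof (rule win_stop[OF True])
        fix w assume w: "agree Q v w"
        have "card Q \<le> \<gamma> * card F" if "feas F w" for F
        proof -
          have "card Q \<le> \<gamma> * card (F \<inter> Q)" using less.prems(6)[OF w that] R by simp
          moreover have "finite F" using that finite_E finite_subset unfolding feas_def by blast
          then have "card (F \<inter> Q) \<le> card F" by (intro card_mono) auto
          then have "\<gamma> * card (F \<inter> Q) \<le> \<gamma> * card F" by (rule mult_le_mono2)
          ultimately show ?thesis by linarith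
        qed
        \<comment> \<open>After an error the consistency half of \<open>good\<close> is
          vacuous.\<close>
        moreover have "w a \<noteq> p a" "a \<in> E" using w err QE unfolding agree_def by auto
        ultimately show "good w Q" unfolding good_def by blast
      qed
    next
      case False
      then obtain W where W: "W \<subseteq> E" "W \<inter> Q = {}" "W \<noteq> {}" "card W \<le> 2"
        "\<And>w F. agree Q v w \<Longrightarrow> feas F w \<Longrightarrow> F \<inter> W \<noteq> {}"
        using witness_set_ex[OF v QE] by blast
      have finW: "finite W" using W finite_E finite_subset by blast
      obtain e where "e \<in> W" using W by blast
      moreover have "card (Q \<union> W) \<le> \<gamma> * card (F \<inter> (Q \<union> W))" if w: "agree Q v w" "feas F w" for w F
      proof -
        have "card (Q \<union> W) = card Q + card W" using finQ finW W by (intro card_Un_disjoint) auto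
        moreover have "F \<inter> (Q \<union> W) = F \<inter> Q \<union> F \<inter> W" by auto
        moreover have "card (F \<inter> Q \<union> F \<inter> W) = card (F \<inter> Q) + card (F \<inter> W)"
          using finQ finW W by (intro card_Un_disjoint) auto
        \<comment> \<open>One hit is worth \<gamma> queries, which pays for the at most two edges of
          \<open>W\<close>.\<close>
        moreover have "1 \<le> card (F \<inter> W)" using W(5)[OF w] finW by (simp add: Suc_le_eq card_gt_0_iff)
        then have "\<gamma> * 1 \<le> \<gamma> * card (F \<inter> W)" by (rule mult_le_mono2)
        moreover have "card Q \<le> \<gamma> * card (F \<inter> Q)" using less.prems(6)[OF w] R by simp
        ultimately show ?thesis using W(4) \<gamma>_ge by (simp only: distrib_left)
      qed
      ultimately show ?thesis using query[OF \<open>e \<in> W\<close> _ W(1)] W(2) by blast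
    qed
  qed
qed

end

section \<open>Following a plan\<close>

text \<open>A plan is computed from the predictions alone. The edges \<open>z t\<close> are to be queried; \<open>x t\<close> is the
  reason for \<open>z t\<close>: as long as the predictions of the earlier \<open>z s\<close> are right, \<open>{x t, z t}\<close> is a
  witness pair, and for \<open>t < m\<close> a right prediction of \<open>x t\<close> makes \<open>z t\<close> mandatory.\<close>

locale query_plan = query_game E base L U p \<gamma>
  for E :: "'e set" and base :: "'e set \<Rightarrow> bool" and L U p :: "'e \<Rightarrow> real" and \<gamma> :: nat +
  fixes z x :: "nat \<Rightarrow> 'e" and m n :: nat
  assumes inj_z: "inj_on z {..<n}"
    and zE: "t < n \<Longrightarrow> z t \<in> E" and xE: "t < n \<Longrightarrow> x t \<in> E"
    and pair: "t < n \<Longrightarrow> agree (z ` {..<t}) p w \<Longrightarrow> feas F w \<Longrightarrow> z t \<in> F \<or> x t \<in> F"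
    and mandatory: "t < n \<Longrightarrow> t < m \<Longrightarrow> agree (z ` {..<t}) p w \<Longrightarrow> feas F w \<Longrightarrow> w (x t) = p (x t) \<Longrightarrow> z t \<in> F"
    and late_new: "t < n \<Longrightarrow> m \<le> t \<Longrightarrow> x t \<notin> z ` {..<n}"
    and late_inj: "s < n \<Longrightarrow> t < n \<Longrightarrow> m \<le> s \<Longrightarrow> m \<le> t \<Longrightarrow> x s = x t \<Longrightarrow> s = t"
    and fresh: "t < n \<Longrightarrow> x t \<notin> z ` {..<t}"
    and final: "feas (z ` {..<n}) p"
begin

definition hub :: "'e \<Rightarrow> bool" where
  "hub a \<longleftrightarrow> a \<in> z ` {..<n} \<or> \<gamma> \<le> card {t. t < n \<and> x t = a}"

definition involved :: "nat \<Rightarrow> 'e set" where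
  "involved k = z ` {..<k} \<union> x ` {..<k}"

text \<open>A reason that is no hub is left out: it is queried, if at all, only after an error, to
  complete its group.\<close>

definition asked :: "nat \<Rightarrow> 'e set" where
  "asked k = z ` {..<k} \<union> {a \<in> x ` {..<k}. hub a}"

text \<open>The form of \<open>group_charging\<close> that applies when an error surfaces in step
  \<open>k - 1\<close>. The error may be at \<open>z (k - 1)\<close>, hence the agreement only on
  the earlier \<open>z\<close>; or at a hub that occurs as a reason for the first time.\<close>

lemma involved_charging:
  assumes k: "k \<le> n" and w: "agree (z ` {..<k - 1}) p w" and F: "feas F w"
    and hubs: "\<And>t. t < k \<Longrightarrow> hub (x t) \<Longrightarrow>
      w (x t) = p (x t) \<or> Suc t = k \<and> x t \<notin> x ` {..<t}"
  shows "card (involved k) \<le> \<gamma> * card (F \<inter> involved k)"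
  unfolding involved_def
proof (rule group_charging[where H = hub])
  show "inj_on z {..<k}" using inj_z k by (auto intro: inj_on_subset)
  show "2 \<le> \<gamma>" by (rule \<gamma>_ge)
  have w': "agree (z ` {..<t}) p w" if "t < k" for t
    by (rule agree_mono[OF w]) (use that in auto)
  fix t assume t: "t < k"
  then have tn: "t < n" using k by simp
  show hit: "z t \<in> F \<or> x t \<in> F" using pair[OF tn w'[OF t] F] .
  {
    assume "\<not> hub (x t)"
    then have "x t \<notin> z ` {..<n}" "card {s. s < n \<and> x s = x t} < \<gamma>" unfolding hub_def by auto
    moreover have "card {s. s < k \<and> x s = x t} \<le> card {s. s < n \<and> x s = x t}"
      using k by (intro card_mono) auto
    ultimately show "x t \<notin> z ` {..<k} \<and> card {s. s < k \<and> x s = x t} < \<gamma>" using k by force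
  }
  assume h: "hub (x t)" "z t \<notin> F"
  show "x t \<notin> z ` {..<k} \<and> (\<forall>s<k. x s = x t \<longrightarrow> s \<noteq> t \<longrightarrow> z s \<in> F)"
  proof (cases "w (x t) = p (x t)")
    case False
    \<comment> \<open>A wrong hub is the reason of the last step only, so its fibre so far is a
      single index.\<close>
    then have *: "k = Suc t" "x t \<notin> x ` {..<t}" using hubs[OF t h(1)] by auto
    have "x t \<noteq> z t" using hit h by auto
    then have "x t \<notin> z ` {..<k}" using fresh[OF tn] unfolding * lessThan_Suc by auto
    moreover have "s = t" if "s < k" "x s = x t" for s
      using that * by (metis image_eqI lessThan_iff less_Suc_eq)
    ultimately show ?thesis by blast
  next
    case True
    \<comment> \<open>With a right reason, a missed \<open>z t\<close> must be late. Its reason is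
      then no \<open>z\<close>, and all other steps with the same reason are early, hence their
      \<open>z\<close> are mandatory.\<close>
    have mt: "m \<le> t" using mandatory[OF tn _ w'[OF t] F True] h(2) not_le by blast
    have "x t \<notin> z ` {..<k}" using late_new[OF tn mt] k by force
    moreover have "z s \<in> F" if s: "s < k" "x s = x t" "s \<noteq> t" for s
    proof -
      have sn: "s < n" using s k by simp
      have "s < m" using late_inj[OF sn tn _ mt] s not_le by blast
      then show ?thesis using mandatory[OF sn _ w'[OF s(1)] F] True s(2) by simp
    qed
    ultimately show ?thesis by blast
  qed
qed

text \<open>Each step contributes its own element of \<open>F\<close>: \<open>z t\<close> if it is
  there, else \<open>x t\<close>. The second case arises only for late steps, whose reasons are
  distinct and differ from all \<open>z\<close>.\<close>

lemma plan_lower_bound: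
  assumes w: "adm w" "\<And>e. e \<in> E \<Longrightarrow> w e = p e" and F: "feas F w"
  shows "n \<le> card F"
proof -
  define g where "g t = (if z t \<in> F then z t else x t)" for t
  have ag: "agree (z ` {..<t}) p w" if "t < n" for t
    using w zE that unfolding agree_def by auto
  have late: "m \<le> t \<and> x t \<in> F" if t: "t < n" "z t \<notin> F" for t
    using pair[OF t(1) ag[OF t(1)] F] mandatory[OF t(1) _ ag[OF t(1)] F] w(2)[OF xE[OF t(1)]] t(2)
    by (meson not_le)
  have "inj_on g {..<n}"
  proof (rule inj_onI)
    fix s t assume st: "s \<in> {..<n}" "t \<in> {..<n}" "g s = g t"
    have new: "x r \<notin> z ` {..<n}" if "r < n" "z r \<notin> F" for r
      using late_new[OF that(1)] late[OF that] by blast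
    consider "z s \<in> F" "z t \<in> F" | "z s \<notin> F" "z t \<in> F" | "z s \<in> F" "z t \<notin> F" | "z s \<notin> F" "z t \<notin> F"
      by blast
    then show "s = t"
    proof cases
      case 1
      then show ?thesis using st inj_z unfolding g_def inj_on_def by simp
    next
      case 2
      then show ?thesis using st new[of s] unfolding g_def by force
    next
      case 3
      then show ?thesis using st new[of t] unfolding g_def by force
    next
      case 4
      then show ?thesis using st late late_inj[of s t] unfolding g_def by simp
    qed
  qed
  moreover have "g ` {..<n} \<subseteq> F" using late unfolding g_def by auto
  moreover have "finite F" using F finite_E finite_subset unfolding feas_def by blast
  ultimately show ?thesis using card_inj_on_le by fastforce
qed

lemma asked_subset: "asked k \<subseteq> involved k"
  unfolding asked_def involved_def by auto

lemma involved_E: "k \<le> n \<Longrightarrow> involved k \<subseteq> E"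
  using zE xE unfolding involved_def by force

lemma asked_E: "k \<le> n \<Longrightarrow> asked k \<subseteq> E"
  using asked_subset involved_E by blast

text \<open>Beyond the \<open>n\<close> edges \<open>z t\<close>, only reasons of at least \<gamma>
  steps are asked, and by \<open>heavy_fibres\<close> there are at most \<open>n / \<gamma>\<close>
  of these.\<close>

lemma card_asked: "\<gamma> * card (asked n) \<le> (\<gamma> + 1) * n"
proof -
  let ?A = "{a \<in> x ` {..<n}. \<gamma> \<le> card {t. t < n \<and> x t = a}}"
  have "asked n \<subseteq> z ` {..<n} \<union> ?A" unfolding asked_def hub_def by auto
  then have "card (asked n) \<le> card (z ` {..<n} \<union> ?A)" by (intro card_mono) auto
  also have "\<dots> \<le> card (z ` {..<n}) + card ?A" by (rule card_Un_le)
  also have "card (z ` {..<n}) = n" using card_image[OF inj_z] by simp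
  finally have "\<gamma> * card (asked n) \<le> \<gamma> * (n + card ?A)" by (rule mult_le_mono2)
  then show ?thesis using heavy_fibres[of \<gamma> x n] by (simp add: distrib_left)
qed

lemma good_asked:
  assumes "agree (asked n) p w"
  shows "good w (asked n)"
  unfolding good_def
proof (intro allI impI conjI)
  fix F assume F: "feas F w"
  have fin: "finite F" using F finite_E finite_subset unfolding feas_def by blast
  have w: "adm w" using assms unfolding agree_def by blast
  have "card (asked n) \<le> card (involved n)"
    using asked_subset involved_E[of n] finite_E finite_subset by (intro card_mono) auto
  also have "\<dots> \<le> \<gamma> * card (F \<inter> involved n)"
  proof (rule involved_charging[OF _ _ F])
    show "agree (z ` {..<n - 1}) p w"
      by (rule agree_mono[OF assms]) (auto simp: asked_def)
    show "w (x t) = p (x t) \<or> Suc t = n \<and> x t \<notin> x ` {..<t}" if "t < n" "hub (x t)" for t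
      using assms that unfolding agree_def asked_def by auto
  qed simp
  also have "\<dots> \<le> \<gamma> * card F" using fin by (intro mult_le_mono2 card_mono) auto
  finally show "card (asked n) \<le> \<gamma> * card F" .
  assume "\<forall>e\<in>E. w e = p e"
  then have "n \<le> card F" using plan_lower_bound[OF w _ F] by blast
  then have "(\<gamma> + 1) * n \<le> (\<gamma> + 1) * card F" by (rule mult_le_mono2)
  then show "\<gamma> * card (asked n) \<le> (\<gamma> + 1) * card F" using card_asked by linarith
qed

lemma asked_mono: "j \<le> k \<Longrightarrow> asked j \<subseteq> asked k"
  unfolding asked_def by auto

lemma asked_Suc:
  "asked (Suc j) = insert (z j) (if hub (x j) then insert (x j) (asked j) else asked j)"
  unfolding asked_def lessThan_Suc by auto

text \<open>Backward induction on the step. Step \<open>j\<close> makes \<open>x j\<close> known if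
  it is a hub, then \<open>z j\<close>. The first wrong answer hands over to
  \<open>win_after_error\<close> with \<open>involved (Suc j)\<close> as the edges paid for.\<close>

lemma win_asked:
  assumes "j \<le> n" "adm v" "\<And>e. e \<in> asked j \<Longrightarrow> v e = p e"
  shows "win (asked j) v"
  using assms
proof (induction "n - j" arbitrary: j v)
  case 0
  then have j: "j = n" by simp
  have 1: "z ` {..<n} \<subseteq> asked n" unfolding asked_def by auto
  have "feas (asked n) p" by (rule feas_mono[OF adm_prediction 1 _ final]) (simp add: asked_E)
  then have "feas (asked n) v" using feas_cong[of "asked n" v p] 0(4) j by simp
  moreover have "good w (asked n)" if "agree (asked n) v w" for w
    by (rule good_asked) (use that 0(4) j in \<open>auto simp: agree_def\<close>)
  ultimately show ?case unfolding j by (rule win_stop)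
next
  case (Suc d)
  note v = Suc.prems(2,3)
  have jn: "j < n" and d: "d = n - Suc j" using Suc.hyps(2) by auto
  have E: "z j \<in> E" "x j \<in> E" "asked j \<subseteq> E" "involved (Suc j) \<subseteq> E"
    using zE xE asked_E involved_E jn by auto
  have asked_inv: "asked j \<subseteq> involved (Suc j)"
    using asked_subset[of "Suc j"] asked_mono[of j "Suc j"] by auto
  \<comment> \<open>The state between the two queries of step \<open>j\<close>.\<close>
  define Q where "Q = (if hub (x j) then insert (x j) (asked j) else asked j)"
  have Q: "asked j \<subseteq> Q" "Q \<subseteq> E" "Q \<subseteq> involved (Suc j)" "hub (x j) \<Longrightarrow> x j \<in> Q"
    using E asked_inv unfolding Q_def involved_def by auto
  have ag: "agree (z ` {..<Suc j - 1}) p w"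
    if "agree S v' w" "asked j \<subseteq> S" "\<And>a. a \<in> asked j \<Longrightarrow> v' a = p a" for S v' w
  proof -
    have "z ` {..<j} \<subseteq> asked j" unfolding asked_def by auto
    then show ?thesis using that unfolding agree_def by (metis diff_Suc_1 subsetD)
  qed
  have hub_asked: "x t \<in> asked j" if "t < j" "hub (x t)" for t
    using that unfolding asked_def by auto
  have second: "win Q v'" if v': "adm v'" "\<And>a. a \<in> Q \<Longrightarrow> v' a = p a" for v'
  proof (rule win_query_known[OF v'(1) E(1)])
    fix u assume u: "adm u" "\<And>a. a \<in> Q \<Longrightarrow> u a = v' a"
    then have up: "u a = p a" if "a \<in> Q" for a using v' that by simp
    have ins: "insert (z j) Q = asked (Suc j)" unfolding Q_def asked_Suc by simp
    show "win (insert (z j) Q) u"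
    proof (cases "u (z j) = p (z j)")
      case True
      have "u e = p e" if "e \<in> asked (Suc j)" for e
        using that True up unfolding ins[symmetric] by blast
      then show ?thesis unfolding ins using Suc.hyps(1)[OF d _ u(1)] jn by simp
    next
      case False
      show ?thesis
      proof (rule win_after_error[OF u(1) _ E(4) _ False])
        show "insert (z j) Q \<subseteq> E" "z j \<in> insert (z j) Q" using E Q by auto
        have un: "insert (z j) Q \<union> involved (Suc j) = involved (Suc j)"
          using Q unfolding involved_def by auto
        fix w F assume w: "agree (insert (z j) Q) u w" "feas F w"
        show "card (insert (z j) Q \<union> involved (Suc j)) \<le> \<gamma> * card (F \<inter> (insert (z j) Q \<union> involved (Suc j)))"
          unfolding un
        proof (rule involved_charging[OF _ _ w(2)])
          show "Suc j \<le> n" using jn by simp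
          show "agree (z ` {..<Suc j - 1}) p w" by (rule ag[OF w(1)]) (use Q up in auto)
          fix t assume t: "t < Suc j" "hub (x t)"
          then have "x t \<in> Q" using hub_asked Q by (metis less_antisym subsetD)
          then show "w (x t) = p (x t) \<or> Suc t = Suc j \<and> x t \<notin> x ` {..<t}"
            using w(1) up unfolding agree_def by auto
        qed
      qed
    qed
  qed
  show ?case
  proof (cases "hub (x j)")
    case False
    then show ?thesis using second[OF v(1)] v(2) unfolding Q_def by simp
  next
    case True
    then have Qj: "Q = insert (x j) (asked j)" unfolding Q_def by simp
    show ?thesis
    proof (rule win_query_known[OF v(1) E(2)])
      fix u assume u: "adm u" "\<And>a. a \<in> asked j \<Longrightarrow> u a = v a"
      then have up: "u a = p a" if "a \<in> asked j" for a using v that by simp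
      show "win (insert (x j) (asked j)) u"
      proof (cases "u (x j) = p (x j)")
        case True
        show ?thesis unfolding Qj[symmetric]
          by (rule second[OF u(1)]) (use True up in \<open>auto simp: Qj\<close>)
      next
        case False
        \<comment> \<open>All asked edges have their predicted values, so a wrong \<open>x j\<close>
          is new. Being a hub, it cannot have been the reason of an earlier step.\<close>
        then have xj: "x j \<notin> asked j" using up by blast
        show ?thesis
        proof (rule win_after_error[OF u(1) _ E(4) _ False])
          show "insert (x j) (asked j) \<subseteq> E" "x j \<in> insert (x j) (asked j)" using E by auto
          have un: "insert (x j) (asked j) \<union> involved (Suc j) = involved (Suc j)"
            using asked_inv unfolding involved_def by auto
          fix w F assume w: "agree (insert (x j) (asked j)) u w" "feas F w"
          show "card (insert (x j) (asked j) \<union> involved (Suc j))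
              \<le> \<gamma> * card (F \<inter> (insert (x j) (asked j) \<union> involved (Suc j)))"
            unfolding un
          proof (rule involved_charging[OF _ _ w(2)])
            show "Suc j \<le> n" using jn by simp
            show "agree (z ` {..<Suc j - 1}) p w" by (rule ag[OF w(1)]) (use up in auto)
            fix t assume t: "t < Suc j" "hub (x t)"
            show "w (x t) = p (x t) \<or> Suc t = Suc j \<and> x t \<notin> x ` {..<t}"
            proof (cases "t = j")
              case True
              then show ?thesis using xj t(2) unfolding asked_def by auto
            next
              case False
              then have "x t \<in> asked j" using hub_asked t by simp
              then show ?thesis using w(1) up unfolding agree_def by auto
            qed
          qed
        qed
      qed
    qed
  qed
qed

lemma win_plan: "win {} p"
  using win_asked[of 0 p] adm_prediction unfolding asked_def by simp

end
section \<open>Constructing a plan\<close>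

lemma sorted_before:
  assumes "sorted (map k xs)" "t < length xs" "e \<in> set xs" "k e < k (xs ! t)"
  shows "e \<in> set (take t xs)"
proof -
  obtain s where s: "s < length xs" "xs ! s = e" using assms(3) by (auto simp: in_set_conv_nth)
  have "s < t"
  proof (rule ccontr)
    assume "\<not> s < t"
    then have "k (xs ! t) \<le> k (xs ! s)" using sorted_nth_mono[OF assms(1), of t s] s assms(2) by simp
    then show False using s assms(4) by simp
  qed
  then show ?thesis using s assms(2) by (auto simp: in_set_conv_nth)
qed

context query_game
begin

text \<open>The case \<open>a = b\<close> is allowed and encodes an edge that belongs to every
  feasible set.\<close>

definition plan_step :: "'e set \<Rightarrow> 'e \<Rightarrow> 'e \<Rightarrow> bool" where
  "plan_step Q a b \<longleftrightarrow> opn Q b \<and> opn Q a \<and> (\<forall>w F. agree Q p w \<longrightarrow> feas F w \<longrightarrow>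
     (b \<in> F \<or> a \<in> F) \<and> (w a = p a \<longrightarrow> b \<in> F))"

definition plan_chain :: "'e list \<Rightarrow> 'e list \<Rightarrow> bool" where
  "plan_chain xs ys \<longleftrightarrow> length xs = length ys \<and> distinct ys \<and> set ys \<subseteq> E \<and>
     (\<forall>t<length ys. plan_step (set (take t ys)) (xs ! t) (ys ! t))"

lemma plan_chain_snoc:
  assumes "plan_chain xs ys" "plan_step (set ys) a b"
  shows "plan_chain (xs @ [a]) (ys @ [b])"
  using assms unfolding plan_chain_def
  by (auto simp: nth_append less_Suc_eq plan_step_def dest: opn_not_in)

lemma maximal_chain:
  obtains xs ys where "plan_chain xs ys" "\<nexists>a b. plan_step (set ys) a b"
proof -
  let ?P = "\<lambda>X. plan_chain (fst X) (snd X)"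
  have "?P ([], [])" unfolding plan_chain_def by simp
  moreover have "\<forall>X. ?P X \<longrightarrow> length (snd X) < Suc (card E)"
    unfolding plan_chain_def using finite_E by (metis card_mono distinct_card le_imp_less_Suc)
  ultimately obtain X where X: "?P X" "\<And>Y. ?P Y \<Longrightarrow> length (snd Y) \<le> length (snd X)"
    using ex_has_greatest_nat[of ?P "([], [])" "\<lambda>X. length (snd X)" "Suc (card E)"] by metis
  have "\<not> plan_step (set (snd X)) a b" for a b
  proof
    assume "plan_step (set (snd X)) a b"
    then have "length (snd X @ [b]) \<le> length (snd X)"
      using X(2)[of "(fst X @ [a], snd X @ [b])"] plan_chain_snoc[OF X(1)] by simp
    then show False by simp
  qed
  then show thesis using that X(1) by blast
qed

text \<open>A mandatory edge would be a step with itself as reason, so a common base exists. In an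
  overlapping exchange, a predicted value inside the interval of the extremal opponent would be a
  reason to query that opponent, again a step.\<close>

lemma no_step_base:
  assumes Q: "Q \<subseteq> E" and no: "\<nexists>a b. plan_step Q a b"
  obtains T where "Lopt Q p T" "Uopt Q p T"
    "\<And>e f. exch T e f \<Longrightarrow> lo Q p f < hi Q p e \<Longrightarrow> opn Q e \<and> opn Q f \<and> hi Q p e \<le> p f \<and> p e \<le> lo Q p f"
  using common_base_or_mandatory[OF adm_prediction Q]
proof cases
  case (1 T)
  show thesis
  proof (rule that[OF 1])
    fix e f assume ef: "exch T e f" and less: "lo Q p f < hi Q p e"
    obtain e' where e': "exch T e' f" "\<And>e''. exch T e'' f \<Longrightarrow> hi Q p e'' \<le> hi Q p e'"
      using max_hi[OF ef] by blast
    have le: "hi Q p e \<le> hi Q p e'" using e'(2)[OF ef] .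
    then have less': "lo Q p f < hi Q p e'" using less by linarith
    note W = agree_witness_hi[OF adm_prediction Q 1 e'(1) less' e'(2)]
    have h: "hi Q p e' \<le> p f"
    proof (rule ccontr)
      assume "\<not> hi Q p e' \<le> p f"
      then have "plan_step Q f e'" unfolding plan_step_def using W by fastforce
      then show False using no by blast
    qed
    obtain f' where f': "exch T e f'" "\<And>f''. exch T e f'' \<Longrightarrow> lo Q p f' \<le> lo Q p f''"
      using min_lo[OF ef] by blast
    have le': "lo Q p f' \<le> lo Q p f" using f'(2)[OF ef] .
    then have less'': "lo Q p f' < hi Q p e" using less by linarith
    note W' = agree_witness_lo[OF adm_prediction Q 1 f'(1) less'' f'(2)]
    have "p e \<le> lo Q p f'"
    proof (rule ccontr)
      assume "\<not> p e \<le> lo Q p f'"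
      then have "plan_step Q e f'" unfolding plan_step_def using W' by fastforce
      then show False using no by blast
    qed
    then show "opn Q e \<and> opn Q f \<and> hi Q p e \<le> p f \<and> p e \<le> lo Q p f"
      using h le le' W(2) W'(1) by linarith
  qed
next
  case (2 e)
  then have "plan_step Q e e" unfolding plan_step_def agree_def by blast
  then show thesis using no by blast
qed

end

section \<open>The cover phase, when predictions force no further edge\<close>

locale stuck_base = query_game E base L U p \<gamma>
  for E :: "'e set" and base :: "'e set \<Rightarrow> bool" and L U p :: "'e \<Rightarrow> real" and \<gamma> :: nat +
  fixes Q :: "'e set" and T :: "'e set"
  assumes QE: "Q \<subseteq> E" and T: "Lopt Q p T" "Uopt Q p T"
    and stuck: "\<And>e f. exch T e f \<Longrightarrow> lo Q p f < hi Q p e \<Longrightarrow>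
      opn Q e \<and> opn Q f \<and> hi Q p e \<le> p f \<and> p e \<le> lo Q p f"
begin

lemma separated: "exch T e f \<Longrightarrow> p e \<le> lo Q p f \<and> hi Q p e \<le> p f"
proof (cases "lo Q p f < hi Q p e")
  case False
  assume "exch T e f"
  then have "e \<in> E" "f \<in> E" using exch_in_E by auto
  then have "p e \<le> hi Q p e" "lo Q p f \<le> p f"
    using adm_bounds[OF adm_prediction] unfolding hi_def lo_def by auto
  then show ?thesis using False by linarith
qed (use stuck in blast)

text \<open>While answers match the predictions, a queried tree edge rises to at most the lower
  limit of \<open>f\<close> by \<open>separated\<close>. Raising \<open>f\<close> does no harm, and
  it breaks a tie strictly if \<open>f\<close> was open.\<close>

lemma Lopt_later: "Lopt (Q \<union> W) p T"
  unfolding Lopt_def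
proof (intro conjI allI impI)
  show "base T" using T unfolding Lopt_def by blast
  fix e f assume ef: "exch T e f"
  have E: "e \<in> E" "f \<in> E" using exch_in_E[OF ef] by auto
  have f: "lo Q p f \<le> lo (Q \<union> W) p f" using bounds_mono(1)[OF adm_prediction E(2)] by simp
  have le: "lo Q p e < lo Q p f \<or> lo Q p e = lo Q p f \<and> (opn Q e \<longrightarrow> opn Q f)"
    using T(1) ef unfolding Lopt_def by blast
  show "lo (Q \<union> W) p e < lo (Q \<union> W) p f \<or>
    lo (Q \<union> W) p e = lo (Q \<union> W) p f \<and> (opn (Q \<union> W) e \<longrightarrow> opn (Q \<union> W) f)"
  proof (cases "e \<in> Q \<union> W")
    case True
    then show ?thesis using separated[OF ef] f unfolding opn_def lo_def by auto
  next
    case False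
    then have [simp]: "lo (Q \<union> W) p e = lo Q p e" unfolding lo_def by simp
    show ?thesis
    proof (cases "lo Q p e = lo (Q \<union> W) p f \<and> opn (Q \<union> W) e")
      case True
      then have 1: "opn Q f" "lo Q p f = lo (Q \<union> W) p f" using le f unfolding opn_def by auto
      have "f \<notin> W"
        using 1 adm_bounds(3)[OF adm_prediction E(2)] unfolding opn_def lo_def by auto
      then show ?thesis using 1 True unfolding opn_def by auto
    next
      case False
      then show ?thesis using le f by auto
    qed
  qed
qed

lemma Uopt_later: "Uopt (Q \<union> W) p T"
  unfolding Uopt_def
proof (intro conjI allI impI)
  show "base T" using T unfolding Lopt_def by blast
  fix e f assume ef: "exch T e f"
  have E: "e \<in> E" "f \<in> E" using exch_in_E[OF ef] by auto
  have e: "hi (Q \<union> W) p e \<le> hi Q p e" using bounds_mono(3)[OF adm_prediction E(1)] by simp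
  have le: "hi Q p e < hi Q p f \<or> hi Q p e = hi Q p f \<and> (opn Q f \<longrightarrow> opn Q e)"
    using T(2) ef unfolding Uopt_def by blast
  show "hi (Q \<union> W) p e < hi (Q \<union> W) p f \<or>
    hi (Q \<union> W) p e = hi (Q \<union> W) p f \<and> (opn (Q \<union> W) f \<longrightarrow> opn (Q \<union> W) e)"
  proof (cases "f \<in> Q \<union> W")
    case True
    then show ?thesis using separated[OF ef] e unfolding opn_def hi_def by auto
  next
    case False
    then have [simp]: "hi (Q \<union> W) p f = hi Q p f" unfolding hi_def by simp
    show ?thesis
    proof (cases "hi (Q \<union> W) p e = hi Q p f \<and> opn (Q \<union> W) f")
      case True
      then have 1: "opn Q e" "hi Q p e = hi (Q \<union> W) p e" using le e unfolding opn_def by auto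
      have "e \<notin> W"
        using 1 adm_bounds(4)[OF adm_prediction E(1)] unfolding opn_def hi_def by auto
      then show ?thesis using 1 True unfolding opn_def by auto
    next
      case False
      then show ?thesis using le e by auto
    qed
  qed
qed

definition conflicts :: "('e \<times> 'e) set" where
  "conflicts = {(e, f). exch T e f \<and> lo Q p f < hi Q p e}"

lemma conflicts_bip: "conflicts \<subseteq> T \<times> (E - T)" "finite conflicts"
proof -
  show *: "conflicts \<subseteq> T \<times> (E - T)" using exch_in_E unfolding conflicts_def exch_def by auto
  have "base T" using T unfolding Lopt_def by blast
  then show "finite conflicts" using * base_finite finite_E by (auto intro: finite_subset)
qed

text \<open>Querying either end settles a conflict, because by \<open>separated\<close> its
  predicted value lies beyond the interval of the other end.\<close>

lemma feas_cover:
  assumes "covers conflicts V" "V \<subseteq> E"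
  shows "feas (Q \<union> V) p"
proof -
  have "hi (Q \<union> V) p e \<le> lo (Q \<union> V) p f" if ef: "exch T e f" for e f
  proof -
    have E: "e \<in> E" "f \<in> E" using exch_in_E[OF ef] by auto
    note b = bounds_mono[OF adm_prediction E(1), of Q "Q \<union> V"] bounds_mono[OF adm_prediction E(2), of Q "Q \<union> V"]
    consider "hi Q p e \<le> lo Q p f" | "e \<in> V" | "f \<in> V"
      using assms(1) ef unfolding covers_def conflicts_def by force
    then show ?thesis
    proof cases
      case 1
      then show ?thesis using b by auto
    next
      case 2
      then show ?thesis using b separated[OF ef] unfolding hi_def[of "Q \<union> V" p e] by auto
    next
      case 3
      then show ?thesis using b separated[OF ef] unfolding lo_def[of "Q \<union> V" p f] by auto
    qed
  qed
  moreover have "base T" using T unfolding Lopt_def by blast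
  ultimately show ?thesis using QE assms(2) unfolding feas_def cert_def by blast
qed

text \<open>As \<open>u\<close> is uncovered, every tree edge in conflict with it is in the cover.
  Those with a larger upper limit than \<open>v\<close> are already known and have dropped to at
  most \<open>lo Q p u\<close>, so \<open>v\<close> is the maximal edge exchangeable for
  \<open>u\<close>.\<close>

lemma cover_witness_hi:
  assumes V: "covers conflicts V" and vm: "(v, u) \<in> conflicts" "u \<notin> V" and W: "W \<subseteq> V" "v \<notin> W"
    and before: "\<And>e. e \<in> V \<inter> T \<Longrightarrow> hi Q p v < hi Q p e \<Longrightarrow> e \<in> W"
    and w: "agree (Q \<union> W) p w" "feas F w" and VE: "V \<subseteq> E"
  shows "v \<in> F \<or> u \<in> F"
proof -
  have vu: "exch T v u" "lo Q p u < hi Q p v" using vm unfolding conflicts_def by auto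
  have same: "lo (Q \<union> W) p u = lo Q p u" "hi (Q \<union> W) p v = hi Q p v"
    using vm(2) W unfolding lo_def hi_def by auto
  have mx: "hi (Q \<union> W) p e \<le> hi (Q \<union> W) p v" if eu: "exch T e u" for e
  proof (rule ccontr)
    assume *: "\<not> ?thesis"
    have eE: "e \<in> E" using exch_in_E[OF eu] by auto
    have gt: "hi Q p v < hi Q p e"
      using * bounds_mono(3)[OF adm_prediction eE, of Q "Q \<union> W"] same by auto
    then have "(e, u) \<in> conflicts" using eu vu unfolding conflicts_def by auto
    then have "e \<in> V \<inter> T" using V vm(2) conflicts_bip unfolding covers_def by blast
    then have "e \<in> W" using before gt by blast
    then have "hi (Q \<union> W) p e = p e" unfolding hi_def by simp
    then show False using * separated[OF eu] vu same by auto
  qed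
  have "Q \<union> W \<subseteq> E" using QE W VE by auto
  then show ?thesis
    using agree_witness_hi(3)[OF adm_prediction _ Lopt_later Uopt_later vu(1) _ mx w] same vu by auto
qed

lemma cover_witness_lo:
  assumes V: "covers conflicts V" and vm: "(u, v) \<in> conflicts" "u \<notin> V" and W: "W \<subseteq> V" "v \<notin> W"
    and before: "\<And>e. e \<in> V - T \<Longrightarrow> lo Q p e < lo Q p v \<Longrightarrow> e \<in> W"
    and w: "agree (Q \<union> W) p w" "feas F w" and VE: "V \<subseteq> E"
  shows "v \<in> F \<or> u \<in> F"
proof -
  have vu: "exch T u v" "lo Q p v < hi Q p u" using vm unfolding conflicts_def by auto
  have same: "lo (Q \<union> W) p v = lo Q p v" "hi (Q \<union> W) p u = hi Q p u"
    using vm(2) W unfolding lo_def hi_def by auto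
  have mn: "lo (Q \<union> W) p v \<le> lo (Q \<union> W) p f" if uf: "exch T u f" for f
  proof (rule ccontr)
    assume *: "\<not> ?thesis"
    have fE: "f \<in> E" using exch_in_E[OF uf] by auto
    have gt: "lo Q p f < lo Q p v"
      using * bounds_mono(1)[OF adm_prediction fE, of Q "Q \<union> W"] same by auto
    then have "(u, f) \<in> conflicts" using uf vu unfolding conflicts_def by auto
    then have "f \<in> V - T" using V vm(2) conflicts_bip unfolding covers_def by blast
    then have "f \<in> W" using before gt by blast
    then have "lo (Q \<union> W) p f = p f" unfolding lo_def by simp
    then show False using * separated[OF uf] vu same by auto
  qed
  have "Q \<union> W \<subseteq> E" using QE W VE by auto
  then show ?thesis
    using agree_witness_lo(3)[OF adm_prediction _ Lopt_later Uopt_later vu(1) _ mn w] same vu by auto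
qed

text \<open>The tree edges of a minimum vertex cover come first, by decreasing upper limit, followed by the
  other edges by increasing lower limit: then each cover edge forms a witness pair with its partner
  in the matching once its predecessors are known.\<close>

lemma cover_phase:
  obtains vs \<mu> where "distinct vs" "feas (Q \<union> set vs) p" "inj_on \<mu> (set vs)"
    "\<And>v. v \<in> set vs \<Longrightarrow> opn Q v \<and> opn Q (\<mu> v) \<and> \<mu> v \<notin> set vs"
    "\<And>t w F. t < length vs \<Longrightarrow> agree (Q \<union> set (take t vs)) p w \<Longrightarrow> feas F w \<Longrightarrow>
      vs ! t \<in> F \<or> \<mu> (vs ! t) \<in> F"
proof -
  obtain V \<mu> where V: "finite V" "covers conflicts V" "inj_on \<mu> V"
    "\<And>v. v \<in> V \<Longrightarrow> \<mu> v \<notin> V \<and> ((v, \<mu> v) \<in> conflicts \<or> (\<mu> v, v) \<in> conflicts)"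
    using min_cover_matching[of conflicts T "E - T"] conflicts_bip by blast
  have opn: "opn Q v \<and> opn Q (\<mu> v) \<and> \<mu> v \<notin> V" if "v \<in> V" for v
    using V(4)[OF that] stuck unfolding conflicts_def by auto
  have VE: "V \<subseteq> E" using opn unfolding opn_def by blast
  obtain as bs where as: "set as = V \<inter> T" "distinct as" and bs: "set bs = V - T" "distinct bs"
    using finite_distinct_list V(1) by (metis finite_Diff finite_Int)
  define as' where "as' = sort_key (\<lambda>e. - hi Q p e) as"
  define bs' where "bs' = sort_key (lo Q p) bs"
  have as': "set as' = V \<inter> T" "distinct as'" "sorted (map (\<lambda>e. - hi Q p e) as')"
    using as unfolding as'_def by (auto simp: sorted_sort_key)
  have bs': "set bs' = V - T" "distinct bs'" "sorted (map (lo Q p) bs')"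
    using bs unfolding bs'_def by (auto simp: sorted_sort_key)
  let ?vs = "as' @ bs'"
  have set: "set ?vs = V" and dist: "distinct ?vs" using as' bs' by auto
  show thesis
  proof (rule that[of ?vs \<mu>])
    show "distinct ?vs" by (rule dist)
    show "feas (Q \<union> set ?vs) p" unfolding set using feas_cover V(2) VE .
    show "inj_on \<mu> (set ?vs)" unfolding set by (rule V(3))
    show "opn Q v \<and> opn Q (\<mu> v) \<and> \<mu> v \<notin> set ?vs" if "v \<in> set ?vs" for v
      using opn that unfolding set .
    fix t w F assume t: "t < length ?vs" and w: "agree (Q \<union> set (take t ?vs)) p w" "feas F w"
    let ?v = "?vs ! t" and ?W = "set (take t ?vs)"
    have v: "?v \<in> V" using nth_mem[OF t] unfolding set .
    have W: "?W \<subseteq> V" using set_take_subset[of t ?vs] unfolding set .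
    have vW: "?v \<notin> ?W"
      using dist t by (auto simp: in_set_conv_nth nth_eq_iff_index_eq simp del: take_append)
    show "?v \<in> F \<or> \<mu> ?v \<in> F"
    proof (cases "t < length as'")
      case True
      then have va: "?v = as' ! t" by (simp add: nth_append)
      then have "?v \<in> T" using nth_mem[OF True] as'(1) by auto
      then have c: "(?v, \<mu> ?v) \<in> conflicts" using V(4)[OF v] conflicts_bip by blast
      show ?thesis
      proof (rule cover_witness_hi[OF V(2) c _ W vW _ w VE])
        fix e assume "e \<in> V \<inter> T" "hi Q p ?v < hi Q p e"
        then have "e \<in> set (take t as')" using sorted_before[OF as'(3) True] as'(1) va by auto
        then show "e \<in> ?W" by simp
      qed (use V(4)[OF v] in blast)
    next
      case False
      then have vb: "?v = bs' ! (t - length as')" and tb: "t - length as' < length bs'"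
        using t by (auto simp: nth_append)
      then have "?v \<notin> T" using nth_mem[OF tb] bs'(1) by auto
      then have c: "(\<mu> ?v, ?v) \<in> conflicts" using V(4)[OF v] conflicts_bip by blast
      show ?thesis
      proof (rule cover_witness_lo[OF V(2) c _ W vW _ w VE])
        fix e assume "e \<in> V - T" "lo Q p e < lo Q p ?v"
        then have "e \<in> set (take (t - length as') bs')" using sorted_before[OF bs'(3) tb] bs'(1) vb by auto
        then show "e \<in> ?W" by simp
      qed (use V(4)[OF v] in blast)
    qed
  qed
qed

end

lemma nth_image_lessThan: "t \<le> length xs \<Longrightarrow> (!) xs ` {..<t} = set (take t xs)"
  by (simp add: lessThan_atLeast0 nth_image)

context query_game
begin

text \<open>The plan is a maximal chain, whose length is \<open>m\<close>, followed by the cover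
  edges with their matching partners as reasons.\<close>

lemma win_start: "win {} p"
proof -
  obtain xs ys where chain: "plan_chain xs ys" and no: "\<nexists>a b. plan_step (set ys) a b"
    by (rule maximal_chain)
  define Q where "Q = set ys"
  have QE: "Q \<subseteq> E" using chain unfolding plan_chain_def Q_def by blast
  obtain T where T: "Lopt Q p T" "Uopt Q p T"
    "\<And>e f. exch T e f \<Longrightarrow> lo Q p f < hi Q p e \<Longrightarrow> opn Q e \<and> opn Q f \<and> hi Q p e \<le> p f \<and> p e \<le> lo Q p f"
    using no_step_base[OF QE] no unfolding Q_def by blast
  interpret stuck_base E base L U p \<gamma> Q T by unfold_locales (use QE T in auto)
  obtain vs \<mu> where vs: "distinct vs" "feas (Q \<union> set vs) p" "inj_on \<mu> (set vs)"
    "\<And>v. v \<in> set vs \<Longrightarrow> opn Q v \<and> opn Q (\<mu> v) \<and> \<mu> v \<notin> set vs"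
    "\<And>t w F. t < length vs \<Longrightarrow> agree (Q \<union> set (take t vs)) p w \<Longrightarrow> feas F w \<Longrightarrow>
      vs ! t \<in> F \<or> \<mu> (vs ! t) \<in> F"
    by (rule cover_phase) (rule that)
  let ?zs = "ys @ vs" and ?xs = "xs @ map \<mu> vs"
  define m n where "m = length ys" and "n = length ?zs"
  have len: "length xs = m" and dy: "distinct ys" using chain unfolding plan_chain_def m_def by auto
  have early: "plan_step (set (take t ?zs)) (?xs ! t) (?zs ! t)" if "t < m" for t
    using chain that len unfolding plan_chain_def m_def by (simp add: nth_append)
  have late: "\<exists>i. i < length vs \<and> t = m + i \<and> ?zs ! t = vs ! i \<and> ?xs ! t = \<mu> (vs ! i) \<and>
      set (take t ?zs) = Q \<union> set (take i vs)" if "m \<le> t" "t < n" for t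
    using that len unfolding m_def n_def Q_def
    by (intro exI[of _ "t - length ys"]) (auto simp: nth_append)
  have img: "(!) ?zs ` {..<t} = set (take t ?zs)" if "t \<le> n" for t
    using nth_image_lessThan[of t ?zs] that unfolding n_def by simp
  have dz: "distinct ?zs" using dy vs(1,4) unfolding Q_def by (auto dest: opn_not_in)
  have "query_plan E base L U p \<gamma> ((!) ?zs) ((!) ?xs) m n"
  proof unfold_locales
    show "inj_on ((!) ?zs) {..<n}" using dz unfolding n_def by (auto intro!: inj_on_nth)
    fix t assume t: "t < n"
    have im: "(!) ?zs ` {..<t} = set (take t ?zs)" using img t by simp
    consider (chain) "t < m" | (cover) "m \<le> t" by linarith
    then have both: "?zs ! t \<in> E \<and> ?xs ! t \<in> E \<and> ?xs ! t \<notin> set (take t ?zs) \<and>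
      (\<forall>w F. agree (set (take t ?zs)) p w \<longrightarrow> feas F w \<longrightarrow> ?zs ! t \<in> F \<or> ?xs ! t \<in> F)"
    proof cases
      case chain
      then show ?thesis using early[OF chain] unfolding plan_step_def by (blast dest: opn_not_in)
    next
      case cover
      obtain i where i: "i < length vs" "?zs ! t = vs ! i" "?xs ! t = \<mu> (vs ! i)"
        "set (take t ?zs) = Q \<union> set (take i vs)" using late[OF cover t] by blast
      show ?thesis unfolding i(2,3,4)
        using vs(4)[of "vs ! i"] vs(5)[OF i(1)] i(1) set_take_subset[of i vs] by (auto dest: opn_not_in)
    qed
    show "?zs ! t \<in> E" "?xs ! t \<in> E" using both by auto
    show "?xs ! t \<notin> (!) ?zs ` {..<t}" unfolding im using both by blast
    show "?zs ! t \<in> F \<or> ?xs ! t \<in> F" if "agree ((!) ?zs ` {..<t}) p w" "feas F w" for w F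
      using both that unfolding im by blast
    show "?zs ! t \<in> F" if "t < m" "agree ((!) ?zs ` {..<t}) p w" "feas F w" "w (?xs ! t) = p (?xs ! t)" for w F
      using early[OF that(1)] that unfolding im plan_step_def by blast
    show "?xs ! t \<notin> (!) ?zs ` {..<n}" if mt: "m \<le> t"
    proof -
      obtain i where i: "i < length vs" "?xs ! t = \<mu> (vs ! i)" using late[OF mt t] by blast
      have "set (take n ?zs) = Q \<union> set vs" unfolding n_def Q_def by simp
      then show ?thesis using img[of n] i vs(4)[of "vs ! i"] by (auto dest: opn_not_in)
    qed
    fix s assume s: "s < n" "m \<le> s" "m \<le> t" "?xs ! s = ?xs ! t"
    obtain i where i: "i < length vs" "t = m + i" "?xs ! t = \<mu> (vs ! i)" using late[OF s(3) t] by blast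
    obtain j where j: "j < length vs" "s = m + j" "?xs ! s = \<mu> (vs ! j)" using late[OF s(2,1)] by blast
    have "vs ! i = vs ! j" using inj_onD[OF vs(3)] s(4) i j by simp
    then show "s = t" using i j vs(1) by (simp add: nth_eq_iff_index_eq)
  next
    have "set (take n ?zs) = Q \<union> set vs" unfolding n_def Q_def by simp
    then show "feas ((!) ?zs ` {..<n}) p" using img[of n] vs(2) by simp
  qed
  then interpret query_plan E base L U p \<gamma> "(!) ?zs" "(!) ?xs" m n .
  show ?thesis by (rule win_plan)
qed

end

section \<open>Spanning trees\<close>

lemma adjacency_mono: "F \<subseteq> F' \<Longrightarrow> (adjacency G F)\<^sup>* \<subseteq> (adjacency G F')\<^sup>*"
  by (rule rtrancl_mono) (auto simp: adjacency_def)

lemma adjacency_sym: "(u, v) \<in> (adjacency G F)\<^sup>* \<Longrightarrow> (v, u) \<in> (adjacency G F)\<^sup>*"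
proof -
  have "sym (adjacency G F)" unfolding adjacency_def sym_def by (auto simp: insert_commute)
  then show "(u, v) \<in> (adjacency G F)\<^sup>* \<Longrightarrow> (v, u) \<in> (adjacency G F)\<^sup>*"
    using sym_rtrancl[of "adjacency G F"] by (auto dest: symD)
qed

lemma adjacency_edge: "f \<in> F \<Longrightarrow> ends G f = {a, b} \<Longrightarrow> (a, b) \<in> (adjacency G F)\<^sup>*"
  by (rule r_into_rtrancl) (auto simp: adjacency_def)

text \<open>The pieces in \<open>N\<close> lead from \<open>a\<close> and \<open>b\<close> to
  different ends of the connection between \<open>u\<close> and \<open>v\<close>; going round
  through it joins \<open>a\<close> to \<open>b\<close>.\<close>

lemma connected_detour:
  assumes "N \<subseteq> F" "(u, v) \<in> (adjacency G F)\<^sup>*"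
    and "(u, a) \<in> (adjacency G N)\<^sup>* \<and> (b, v) \<in> (adjacency G N)\<^sup>* \<or>
      (u, b) \<in> (adjacency G N)\<^sup>* \<and> (a, v) \<in> (adjacency G N)\<^sup>*"
  shows "(a, b) \<in> (adjacency G F)\<^sup>*"
  using assms(3)
proof (elim disjE conjE)
  assume ua: "(u, a) \<in> (adjacency G N)\<^sup>*" and bv: "(b, v) \<in> (adjacency G N)\<^sup>*"
  have "(a, u) \<in> (adjacency G F)\<^sup>*" "(v, b) \<in> (adjacency G F)\<^sup>*"
    using adjacency_sym[OF ua] adjacency_sym[OF bv] adjacency_mono[OF assms(1)] by (meson subsetD)+
  then show ?thesis using assms(2) by (meson rtrancl_trans)
next
  assume ub: "(u, b) \<in> (adjacency G N)\<^sup>*" and av: "(a, v) \<in> (adjacency G N)\<^sup>*"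
  have "(u, b) \<in> (adjacency G F)\<^sup>*" "(a, v) \<in> (adjacency G F)\<^sup>*"
    using ub av adjacency_mono[OF assms(1)] by (meson subsetD)+
  moreover have "(v, u) \<in> (adjacency G F)\<^sup>*" using assms(2) by (rule adjacency_sym)
  ultimately show ?thesis by (meson rtrancl_trans)
qed

text \<open>A walk needs \<open>f\<close> at most once, in one of two directions: traversing it
  again only changes the case.\<close>

lemma connected_insert:
  assumes "(s, t) \<in> (adjacency G (insert f F))\<^sup>*" and f: "ends G f = {a, b}"
  shows "(s, t) \<in> (adjacency G F)\<^sup>* \<or>
    (s, a) \<in> (adjacency G F)\<^sup>* \<and> (b, t) \<in> (adjacency G F)\<^sup>* \<or>
    (s, b) \<in> (adjacency G F)\<^sup>* \<and> (a, t) \<in> (adjacency G F)\<^sup>*"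
  using assms(1)
proof (induction rule: rtrancl_induct)
  case (step y z)
  then obtain g where g: "g \<in> insert f F" "ends G g = {y, z}" unfolding adjacency_def by auto
  show ?case
  proof (cases "g \<in> F")
    case True
    then have "(y, z) \<in> adjacency G F" using g unfolding adjacency_def by auto
    then show ?thesis using step.IH by (meson rtrancl.rtrancl_into_rtrancl)
  next
    case False
    then have "{y, z} = {a, b}" using g f by auto
    then have "y = a \<and> z = b \<or> y = b \<and> z = a" by (auto simp: doubleton_eq_iff)
    then show ?thesis using step.IH by auto
  qed
qed simp

lemma redundant_edge:
  assumes "(a, b) \<in> (adjacency G F)\<^sup>*" "ends G f = {a, b}"
  shows "(adjacency G (insert f F))\<^sup>* = (adjacency G F)\<^sup>*"
proof
  show "(adjacency G (insert f F))\<^sup>* \<subseteq> (adjacency G F)\<^sup>*"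
  proof (rule subrelI)
    fix s t assume "(s, t) \<in> (adjacency G (insert f F))\<^sup>*"
    from connected_insert[OF this assms(2)] show "(s, t) \<in> (adjacency G F)\<^sup>*"
      using assms(1) adjacency_sym[OF assms(1)] by (meson rtrancl_trans)
  qed
qed (rule adjacency_mono, auto)

lemma crossing_edge:
  assumes "(u, v) \<in> (adjacency G F)\<^sup>*" "u \<in> C" "v \<notin> C"
  shows "\<exists>f\<in>F. \<exists>a b. ends G f = {a, b} \<and> a \<in> C \<and> b \<notin> C"
  using assms
proof (induction rule: rtrancl_induct)
  case (step y z)
  then show ?case unfolding adjacency_def by blast
qed simp

lemma simple_path:
  assumes "(u, v) \<in> (adjacency G F)\<^sup>*"
  shows "\<exists>vs es. length vs = Suc (length es) \<and> vs ! 0 = u \<and> vs ! length es = v \<and> distinct vs \<and>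
    (\<forall>i<length es. es ! i \<in> F \<and> ends G (es ! i) = {vs ! i, vs ! Suc i})"
  using assms
proof (induction rule: converse_rtrancl_induct)
  case base
  show ?case by (intro exI[of _ "[v]"] exI[of _ "[]"]) simp
next
  case (step u y)
  then obtain e where e: "e \<in> F" "ends G e = {u, y}" unfolding adjacency_def by auto
  obtain vs es where p: "length vs = Suc (length es)" "vs ! 0 = y" "vs ! length es = v" "distinct vs"
    "\<And>i. i < length es \<Longrightarrow> es ! i \<in> F \<and> ends G (es ! i) = {vs ! i, vs ! Suc i}"
    using step.IH by blast
  show ?case
  proof (cases "u \<in> set vs")
    case False
    have "(e # es) ! i \<in> F \<and> ends G ((e # es) ! i) = {(u # vs) ! i, (u # vs) ! Suc i}"
      if "i < length (e # es)" for i
      using that e p by (cases i) auto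
    then show ?thesis using False p by (intro exI[of _ "u # vs"] exI[of _ "e # es"]) auto
  next
    case True
    then obtain k where k: "k < length vs" "vs ! k = u" by (auto simp: in_set_conv_nth)
    \<comment> \<open>If \<open>u\<close> is already on the path, only the part from
      \<open>u\<close> onwards is kept.\<close>
    then show ?thesis using p by (intro exI[of _ "drop k vs"] exI[of _ "drop k es"]) auto
  qed
qed

text \<open>A simple path between the ends of \<open>e\<close>, closed by \<open>e\<close>. For a
  loop the path has no edges and the cycle has length 1.\<close>

lemma cycle_if_edge_spanned:
  assumes uv: "(u, v) \<in> (adjacency G (T - {e}))\<^sup>*" and e: "e \<in> T" "ends G e = {u, v}"
  shows "\<exists>vs es. is_cycle G vs es \<and> set es \<subseteq> T"
proof -
  obtain vs es where p: "length vs = Suc (length es)" "vs ! 0 = u" "vs ! length es = v" "distinct vs"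
    "\<And>i. i < length es \<Longrightarrow> es ! i \<in> T - {e} \<and> ends G (es ! i) = {vs ! i, vs ! Suc i}"
    using simple_path[OF uv] by blast
  have neq: "es ! i \<noteq> es ! j" if "i < j" "j < length es" for i j
  proof
    assume "es ! i = es ! j"
    then have "vs ! i \<in> {vs ! j, vs ! Suc j}" using p(5)[of i] p(5)[of j] that by auto
    then show False using p(1,4) that by (auto simp: nth_eq_iff_index_eq)
  qed
  have "distinct es" unfolding distinct_conv_nth using neq by (metis linorder_neqE_nat)
  moreover have sub: "set es \<subseteq> T - {e}" unfolding set_conv_nth using p(5) by blast
  moreover have "ends G ((es @ [e]) ! i) = {vs ! i, vs ! (Suc i mod length (es @ [e]))}"
    if "i < length (es @ [e])" for i
  proof (cases "i < length es")
    case True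
    then show ?thesis using p(5) by (simp add: nth_append)
  next
    case False
    then have "i = length es" using that by simp
    then show ?thesis using p e by (simp add: insert_commute)
  qed
  ultimately have "is_cycle G vs (es @ [e])" using p unfolding is_cycle_def by auto
  moreover have "set (es @ [e]) \<subseteq> T" using sub e by auto
  ultimately show ?thesis by blast
qed

lemma cycle_redundant_edge:
  assumes c: "is_cycle G vs es" "set es \<subseteq> T"
  shows "\<exists>e\<in>T. (adjacency G (T - {e}))\<^sup>* = (adjacency G T)\<^sup>*"
proof -
  obtain n where n: "length es = Suc n" using c unfolding is_cycle_def by (cases es) auto
  have ends: "ends G (es ! i) = {vs ! i, vs ! (Suc i mod Suc n)}" if "i < Suc n" for i
    using c n that unfolding is_cycle_def by auto
  define e where "e = es ! n"
  have e: "e \<in> T" "ends G e = {vs ! n, vs ! 0}" using c(2) n ends[of n] unfolding e_def by auto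
  have "(vs ! 0, vs ! i) \<in> (adjacency G (T - {e}))\<^sup>*" if "i \<le> n" for i
    using that
  proof (induction i)
    case (Suc i)
    have "es ! i \<noteq> e" "es ! i \<in> T"
      using c n Suc.prems unfolding is_cycle_def e_def by (auto simp: nth_eq_iff_index_eq)
    moreover have "ends G (es ! i) = {vs ! i, vs ! Suc i}" using ends[of i] Suc.prems by simp
    ultimately have "(vs ! i, vs ! Suc i) \<in> (adjacency G (T - {e}))\<^sup>*"
      by (intro adjacency_edge[of "es ! i"]) auto
    moreover have "(vs ! 0, vs ! i) \<in> (adjacency G (T - {e}))\<^sup>*" using Suc by simp
    ultimately show ?case by (rule rtrancl_trans[rotated])
  qed simp
  then have "(vs ! n, vs ! 0) \<in> (adjacency G (T - {e}))\<^sup>*" by (rule adjacency_sym) simp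
  from redundant_edge[OF this e(2)] show ?thesis using e(1) by (auto simp: insert_absorb)
qed

locale connected_multigraph =
  fixes G :: "('v, 'e, 'z) multigraph_scheme"
  assumes multigraph: "multigraph G" and connected: "connects G (edges G)"
begin

lemma edge_ends:
  assumes "e \<in> edges G"
  obtains u v where "u \<in> verts G" "v \<in> verts G" "ends G e = {u, v}"
  using multigraph assms unfolding multigraph_def by blast

lemma connects_mono: "connects G F \<Longrightarrow> (adjacency G F)\<^sup>* \<subseteq> (adjacency G F')\<^sup>* \<Longrightarrow> connects G F'"
  unfolding connects_def by blast

text \<open>Trees as minimal connecting sets: from here on only reachability is used, not
  cycles.\<close>

lemma spanning_tree_iff:
  "spanning_tree G T \<longleftrightarrow> T \<subseteq> edges G \<and> connects G T \<and> (\<forall>e\<in>T. \<not> connects G (T - {e}))"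
proof -
  have "(\<exists>vs es. is_cycle G vs es \<and> set es \<subseteq> T) \<longleftrightarrow> (\<exists>e\<in>T. connects G (T - {e}))"
    if T: "T \<subseteq> edges G" "connects G T"
  proof
    assume "\<exists>vs es. is_cycle G vs es \<and> set es \<subseteq> T"
    then obtain e where "e \<in> T" "(adjacency G (T - {e}))\<^sup>* = (adjacency G T)\<^sup>*"
      using cycle_redundant_edge by blast
    then show "\<exists>e\<in>T. connects G (T - {e})" using connects_mono[OF T(2)] by blast
  next
    assume "\<exists>e\<in>T. connects G (T - {e})"
    then obtain e where e: "e \<in> T" "connects G (T - {e})" by blast
    then obtain u v where "u \<in> verts G" "v \<in> verts G" "ends G e = {u, v}" using edge_ends T by blast
    then show "\<exists>vs es. is_cycle G vs es \<and> set es \<subseteq> T"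
      using cycle_if_edge_spanned[of u v G T e] e unfolding connects_def by blast
  qed
  then show ?thesis unfolding spanning_tree_def by blast
qed

lemma tree_edge_not_spanned:
  assumes "spanning_tree G T" "e \<in> T" "ends G e = {u, v}"
  shows "(u, v) \<notin> (adjacency G (T - {e}))\<^sup>*"
  using assms cycle_if_edge_spanned[of u v G T e] unfolding spanning_tree_def by blast

lemma spanning_tree_swap:
  assumes T: "spanning_tree G T" and e: "e \<in> T" and f: "f \<in> edges G" "f \<notin> T"
    and con: "connects G (insert f (T - {e}))"
  shows "spanning_tree G (insert f (T - {e}))"
  unfolding spanning_tree_iff
proof (intro conjI ballI con)
  have TE: "T \<subseteq> edges G" "\<And>e. e \<in> T \<Longrightarrow> \<not> connects G (T - {e})"
    using T unfolding spanning_tree_iff by auto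
  show "insert f (T - {e}) \<subseteq> edges G" using TE f by auto
  fix g assume g: "g \<in> insert f (T - {e})"
  show "\<not> connects G (insert f (T - {e}) - {g})"
  proof (cases "g = f")
    case True
    then have "insert f (T - {e}) - {g} = T - {e}" using f by auto
    then show ?thesis using TE(2)[OF e] by simp
  next
    case False
    define N where "N = T - {e} - {g}"
    have eqs: "insert f (T - {e}) - {g} = insert f N" "T - {g} = insert e N" "T - {e} = insert g N"
      using False g e unfolding N_def by auto
    show ?thesis
    proof
      assume "connects G (insert f (T - {e}) - {g})"
      then have c: "connects G (insert f N)" unfolding eqs(1) .
      obtain u v where uv: "u \<in> verts G" "v \<in> verts G" "ends G e = {u, v}"
        using edge_ends TE e by blast
      obtain a b where ab: "a \<in> verts G" "b \<in> verts G" "ends G f = {a, b}"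
        using edge_ends f by blast
      have not_uv: "(u, v) \<notin> (adjacency G N)\<^sup>*"
        using tree_edge_not_spanned[OF T e uv(3)] adjacency_mono[of N "T - {e}" G]
        unfolding N_def by blast
      have "(u, v) \<in> (adjacency G (insert f N))\<^sup>*" using c uv unfolding connects_def by blast
      from connected_insert[OF this ab(3)] not_uv
      have detour: "(u, a) \<in> (adjacency G N)\<^sup>* \<and> (b, v) \<in> (adjacency G N)\<^sup>* \<or>
          (u, b) \<in> (adjacency G N)\<^sup>* \<and> (a, v) \<in> (adjacency G N)\<^sup>*"
        by argo
      have "(u, v) \<in> (adjacency G (insert e N))\<^sup>*" using uv(3) by (intro adjacency_edge[of e]) auto
      from connected_detour[OF _ this detour] have "(a, b) \<in> (adjacency G (insert e N))\<^sup>*" by blast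
      then have "(adjacency G (insert f (insert e N)))\<^sup>* = (adjacency G (insert e N))\<^sup>*"
        using redundant_edge ab(3) by metis
      moreover have "(adjacency G (insert f N))\<^sup>* \<subseteq> (adjacency G (insert f (insert e N)))\<^sup>*"
        by (rule adjacency_mono) auto
      ultimately have "connects G (T - {g})" unfolding eqs(2) using connects_mono[OF c] by simp
      then show False using TE(2)[of g] g False by blast
    qed
  qed
qed

lemma spanning_tree_ex: "\<exists>T. spanning_tree G T"
proof -
  have fin: "finite (edges G)" using multigraph unfolding multigraph_def by blast
  obtain T where T: "T \<subseteq> edges G" "connects G T"
    "\<And>S. S \<subseteq> edges G \<Longrightarrow> connects G S \<Longrightarrow> card T \<le> card S"
    using ex_has_least_nat[of "\<lambda>T. T \<subseteq> edges G \<and> connects G T" "edges G" card] connected by blast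
  have "\<not> connects G (T - {e})" if e: "e \<in> T" for e
  proof
    assume "connects G (T - {e})"
    then have "card T \<le> card (T - {e})" using T(1) by (intro T(3)) auto
    moreover have "card (T - {e}) < card T"
      using e finite_subset[OF T(1) fin] by (intro psubset_card_mono) auto
    ultimately show False by simp
  qed
  then show ?thesis unfolding spanning_tree_iff using T by blast
qed

text \<open>Removing \<open>e\<close> from \<open>T\<close> cuts off a component \<open>C\<close>,
  and the path in \<open>T'\<close> between the ends of \<open>e\<close> leaves \<open>C\<close>
  along some \<open>f\<close>. Crossing the cut makes \<open>f\<close> replace \<open>e\<close> in
  \<open>T\<close>; lying on the path makes \<open>e\<close> replace \<open>f\<close> in
  \<open>T'\<close>.\<close>

lemma spanning_tree_exchange:
  assumes T: "spanning_tree G T" and T': "spanning_tree G T'" and e: "e \<in> T" "e \<notin> T'"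
  shows "\<exists>f. f \<in> T' \<and> f \<notin> T \<and> spanning_tree G (insert f (T - {e})) \<and>
    spanning_tree G (insert e (T' - {f}))"
proof -
  have TE: "T \<subseteq> edges G" "T' \<subseteq> edges G" "connects G T" "connects G T'"
    using T T' unfolding spanning_tree_iff by auto
  have fin: "finite (edges G)" using multigraph unfolding multigraph_def by blast
  obtain u v where uv: "u \<in> verts G" "v \<in> verts G" "ends G e = {u, v}" using edge_ends TE e by blast
  have "(u, v) \<in> (adjacency G T')\<^sup>*" using TE uv unfolding connects_def by blast
  \<comment> \<open>A smallest edge set of \<open>T'\<close> joining the ends of \<open>e\<close>
    stands for the path.\<close>
  then have "\<exists>P. (P \<subseteq> T' \<and> (u, v) \<in> (adjacency G P)\<^sup>*) \<and>
      (\<forall>S. S \<subseteq> T' \<and> (u, v) \<in> (adjacency G S)\<^sup>* \<longrightarrow> card P \<le> card S)"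
    by (intro ex_has_least_nat[of "\<lambda>P. P \<subseteq> T' \<and> (u, v) \<in> (adjacency G P)\<^sup>*" T' card]) simp
  then obtain P where P: "P \<subseteq> T'" "(u, v) \<in> (adjacency G P)\<^sup>*"
    "\<And>S. S \<subseteq> T' \<Longrightarrow> (u, v) \<in> (adjacency G S)\<^sup>* \<Longrightarrow> card P \<le> card S"
    by metis
  let ?N = "T - {e}"
  define C where "C = {y. (u, y) \<in> (adjacency G ?N)\<^sup>*}"
  have uC: "u \<in> C" "v \<notin> C" using tree_edge_not_spanned[OF T e(1) uv(3)] unfolding C_def by auto
  then obtain f a b where f: "f \<in> P" "ends G f = {a, b}" "a \<in> C" "b \<notin> C"
    using crossing_edge[OF P(2) uC] by (elim bexE exE conjE) (rule that)
  have fT': "f \<in> T'" "f \<in> edges G" using f P TE by auto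
  have fT: "f \<notin> T"
  proof
    assume "f \<in> T"
    then have "f \<in> ?N" using fT' e by auto
    then have "(a, b) \<in> (adjacency G ?N)\<^sup>*" using f(2) by (rule adjacency_edge)
    then have "b \<in> C" using f(3) unfolding C_def by (simp add: rtrancl_trans)
    then show False using f(4) by blast
  qed
  have ins: "insert e ?N = T" "insert f (T' - {f}) = T'" using e fT' by auto
  have "connects G (insert f ?N)"
  proof (rule connects_mono[OF TE(3)])
    have sub: "(adjacency G ?N)\<^sup>* \<subseteq> (adjacency G (insert f ?N))\<^sup>*" by (rule adjacency_mono) auto
    have "b \<in> verts G" using edge_ends[OF fT'(2)] f(2) by (metis insertCI insertE singletonD)
    then have ub: "(u, b) \<in> (adjacency G (insert e ?N))\<^sup>*" using TE(3) uv unfolding ins connects_def by blast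
    have vb: "(v, b) \<in> (adjacency G ?N)\<^sup>*"
      using connected_insert[OF ub uv(3)] f(4) unfolding C_def by (elim disjE) auto
    have "(b, v) \<in> (adjacency G ?N)\<^sup>*" using adjacency_sym[OF vb] .
    moreover have "(u, a) \<in> (adjacency G ?N)\<^sup>*" using f(3) unfolding C_def by blast
    moreover have "(a, b) \<in> (adjacency G (insert f ?N))\<^sup>*" using f(2) by (intro adjacency_edge[of f]) auto
    ultimately have "(u, v) \<in> (adjacency G (insert f ?N))\<^sup>*"
      using sub by (meson rtrancl_trans subsetD)
    then have "(adjacency G (insert e (insert f ?N)))\<^sup>* = (adjacency G (insert f ?N))\<^sup>*"
      using redundant_edge uv(3) by metis
    moreover have "(adjacency G T)\<^sup>* \<subseteq> (adjacency G (insert e (insert f ?N)))\<^sup>*"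
      by (rule adjacency_mono) auto
    ultimately show "(adjacency G T)\<^sup>* \<subseteq> (adjacency G (insert f ?N))\<^sup>*" by simp
  qed
  then have 1: "spanning_tree G (insert f ?N)"
    using spanning_tree_swap[OF T e(1) fT'(2) fT] by blast
  let ?M = "insert e (T' - {f})"
  have "connects G ?M"
  proof (rule connects_mono[OF TE(4)])
    \<comment> \<open>By minimality of \<open>P\<close>, every connection of \<open>u\<close> and
      \<open>v\<close> inside \<open>P\<close> uses \<open>f\<close>.\<close>
    have not_uv: "(u, v) \<notin> (adjacency G (P - {f}))\<^sup>*"
    proof
      assume less: "(u, v) \<in> (adjacency G (P - {f}))\<^sup>*"
      have "P - {f} \<subseteq> T'" using P(1) by blast
      then have "card P \<le> card (P - {f})" using less by (rule P(3))
      moreover have "finite P" using finite_subset[OF subset_trans[OF P(1) TE(2)] fin] .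
      then have "card (P - {f}) < card P" using f(1) by (intro psubset_card_mono) auto
      ultimately show False by simp
    qed
    have "(u, v) \<in> (adjacency G (insert f (P - {f})))\<^sup>*" using P(2) f(1) by (simp add: insert_absorb)
    from connected_insert[OF this f(2)] not_uv
    have detour: "(u, a) \<in> (adjacency G (P - {f}))\<^sup>* \<and> (b, v) \<in> (adjacency G (P - {f}))\<^sup>* \<or>
        (u, b) \<in> (adjacency G (P - {f}))\<^sup>* \<and> (a, v) \<in> (adjacency G (P - {f}))\<^sup>*"
      by argo
    have uvM: "(u, v) \<in> (adjacency G ?M)\<^sup>*" using uv(3) by (intro adjacency_edge[of e]) auto
    have "P - {f} \<subseteq> ?M" using P(1) by blast
    from connected_detour[OF this uvM detour] have "(a, b) \<in> (adjacency G ?M)\<^sup>*" .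
    then have "(adjacency G (insert f ?M))\<^sup>* = (adjacency G ?M)\<^sup>*" using redundant_edge f(2) by metis
    moreover have "(adjacency G T')\<^sup>* \<subseteq> (adjacency G (insert f ?M))\<^sup>*" by (rule adjacency_mono) auto
    ultimately show "(adjacency G T')\<^sup>* \<subseteq> (adjacency G ?M)\<^sup>*" by simp
  qed
  moreover have "e \<in> edges G" using TE e by auto
  ultimately have "spanning_tree G ?M"
    using spanning_tree_swap[OF T' fT'(1) _ e(2)] by blast
  then show ?thesis using 1 fT fT' by blast
qed

lemma base_system: "base_system (edges G) (spanning_tree G)"
proof
  show "finite (edges G)" using multigraph unfolding multigraph_def by blast
  show "T \<subseteq> edges G" if "spanning_tree G T" for T using that unfolding spanning_tree_def by blast
  show "\<exists>T. spanning_tree G T" by (rule spanning_tree_ex)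
qed (rule spanning_tree_exchange)

end

section \<open>The algorithm\<close>

lemma uncertainty_interval_eq: "uncertainty_interval P e = value_range (lower P e) (upper P e)"
  unfolding uncertainty_interval_def value_range_def by simp

definition reveal :: "('e \<times> real) list \<Rightarrow> ('e \<Rightarrow> real) \<Rightarrow> 'e \<Rightarrow> real" where
  "reveal h v = fold (\<lambda>(e, y) v. v(e := y)) h v"

text \<open>Stated outside the locale \<open>mst_game\<close>, so that the algorithm is a function
  of the input and the history and cannot refer to \<open>w\<close>.\<close>

definition game_win ::
    "nat \<Rightarrow> ('v, 'e) mst_input \<Rightarrow> 'e set \<Rightarrow> ('e \<Rightarrow> real) \<Rightarrow> bool" where
  "game_win \<gamma> P = query_game.win (edges P) (spanning_tree P) (lower P) (upper P) (prediction P) \<gamma>"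

definition winning_query ::
    "nat \<Rightarrow> ('v, 'e) mst_input \<Rightarrow> ('e \<times> real) list \<Rightarrow> 'e \<Rightarrow> bool" where
  "winning_query \<gamma> P h e \<longleftrightarrow> e \<in> edges P \<and> e \<notin> queried h \<and>
     (\<forall>y\<in>uncertainty_interval P e.
        game_win \<gamma> P (insert e (queried h)) ((reveal h (prediction P))(e := y)))"

definition winning_algorithm :: "nat \<Rightarrow> ('v, 'e) query_algorithm" where
  "winning_algorithm \<gamma> P h = (SOME e. winning_query \<gamma> P h e)"

locale mst_game =
  fixes P :: "('v, 'e) mst_input" and w :: "'e \<Rightarrow> real" and \<gamma> :: nat
  assumes inst: "mst_instance P w" and \<gamma>_ge_2: "2 \<le> \<gamma>"

sublocale mst_game \<subseteq> connected_multigraph P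
  using inst unfolding mst_instance_def by unfold_locales auto

sublocale mst_game \<subseteq> query_game "edges P" "spanning_tree P" "lower P" "upper P" "prediction P" \<gamma>
proof -
  interpret base_system "edges P" "spanning_tree P" by (rule base_system)
  show "query_game (edges P) (spanning_tree P) (lower P) (upper P) (prediction P) \<gamma>"
    by unfold_locales (use inst \<gamma>_ge_2 in \<open>auto simp: mst_instance_def uncertainty_interval_eq\<close>)
qed

context mst_game
begin

lemma adm_w: "adm w"
  using inst unfolding adm_def mst_instance_def uncertainty_interval_eq by blast

lemma possible_weights_bounds:
  assumes "possible_weights P w Q w'" "e \<in> edges P"
  shows "lo Q w e \<le> w' e" "w' e \<le> hi Q w e"
  using assms unfolding possible_weights_def lo_def hi_def uncertainty_interval_eq value_range_def
  by (auto split: if_splits dest!: bspec[where x = e])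

text \<open>An open interval does not attain its limit, so values beyond a given threshold stand in
  for it.\<close>

lemma possible_below:
  assumes "e \<in> edges P" "lo Q w e < c"
  obtains y where "y < c" "e \<in> Q \<Longrightarrow> y = w e" "e \<notin> Q \<Longrightarrow> y \<in> uncertainty_interval P e"
proof (cases "e \<in> Q \<or> lower P e = upper P e")
  case True
  then show thesis using that[of "lo Q w e"] assms
    unfolding lo_def uncertainty_interval_def by (auto split: if_splits)
next
  case False
  then have "lower P e < min c (upper P e)"
    using assms adm_bounds(5)[OF adm_w] unfolding lo_def by (auto simp: less_le)
  then obtain y where "lower P e < y" "y < min c (upper P e)" using dense by blast
  then show thesis using that[of y] False unfolding uncertainty_interval_def by auto
qed

lemma possible_above:
  assumes "e \<in> edges P" "c < hi Q w e"
  obtains y where "c < y" "e \<in> Q \<Longrightarrow> y = w e" "e \<notin> Q \<Longrightarrow> y \<in> uncertainty_interval P e"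
proof (cases "e \<in> Q \<or> lower P e = upper P e")
  case True
  then show thesis using that[of "hi Q w e"] assms
    unfolding hi_def uncertainty_interval_def by (auto split: if_splits)
next
  case False
  then have "max c (lower P e) < upper P e"
    using assms adm_bounds(5)[OF adm_w] unfolding hi_def by (auto simp: less_le)
  then obtain y where "max c (lower P e) < y" "y < upper P e" using dense by blast
  then show thesis using that[of y] False unfolding uncertainty_interval_def by auto
qed

text \<open>If an exchange violates the limits, a threshold \<open>c\<close> between them is chosen,
  with a possible value of \<open>f\<close> below it and one of \<open>e\<close> above it: then
  \<open>T\<close> is not minimal. Conversely, local minimality implies minimality for each possible
  weight.\<close>

lemma feasible_iff: "feasible_query_set P w Q \<longleftrightarrow> feas Q w"
proof -
  have "(\<forall>w'. possible_weights P w Q w' \<longrightarrow> minimum_spanning_tree P w' T) \<longleftrightarrow> cert Q w T"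
    if T: "spanning_tree P T" for T
  proof
    assume c: "cert Q w T"
    show "\<forall>w'. possible_weights P w Q w' \<longrightarrow> minimum_spanning_tree P w' T"
    proof (intro allI impI)
      fix w' assume w': "possible_weights P w Q w'"
      have "w' e \<le> w' f" if ef: "exch T e f" for e f
      proof -
        have "hi Q w e \<le> lo Q w f" using c ef unfolding cert_def by blast
        then show ?thesis using possible_weights_bounds[OF w'] exch_in_E[OF ef] by (meson order_trans)
      qed
      then have "sum w' T \<le> sum w' T'" if "spanning_tree P T'" for T'
        using locally_minimal_imp_minimal[OF T, of w'] that by metis
      then show "minimum_spanning_tree P w' T"
        using T unfolding minimum_spanning_tree_def is_arg_min_def by (simp add: not_less)
    qed
  next
    assume m: "\<forall>w'. possible_weights P w Q w' \<longrightarrow> minimum_spanning_tree P w' T"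
    have "hi Q w e \<le> lo Q w f" if ef: "exch T e f" for e f
    proof (rule ccontr)
      assume "\<not> hi Q w e \<le> lo Q w f"
      then have "lo Q w f < hi Q w e" by simp
      then obtain c where c: "lo Q w f < c" "c < hi Q w e" using dense by blast
      have E: "e \<in> edges P" "f \<in> edges P" "e \<noteq> f"
        using exch_in_E[OF ef] ef unfolding exch_def by auto
      obtain x where x: "x < c" "f \<in> Q \<Longrightarrow> x = w f" "f \<notin> Q \<Longrightarrow> x \<in> uncertainty_interval P f"
        using possible_below[OF E(2) c(1)] by blast
      obtain y where y: "c < y" "e \<in> Q \<Longrightarrow> y = w e" "e \<notin> Q \<Longrightarrow> y \<in> uncertainty_interval P e"
        using possible_above[OF E(1) c(2)] by blast
      define u where "u = w(f := x, e := y)"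
      have "possible_weights P w Q u"
        using x y inst unfolding u_def possible_weights_def mst_instance_def by auto
      then have "minimum_spanning_tree P u T" using m by blast
      then have "u e \<le> u f"
        by (intro minimal_imp_locally_minimal[OF _ ef])
          (simp add: minimum_spanning_tree_def is_arg_min_def not_less)
      then show False using x(1) y(1) E(3) unfolding u_def by simp
    qed
    then show "cert Q w T" using T unfolding cert_def by blast
  qed
  then show ?thesis unfolding feasible_query_set_def feas_def cert_def by blast
qed

text \<open>While the queried set is infeasible, \<open>win\<close> can only stem from
  \<open>win_query\<close>, so the choice in the algorithm has a witness. The count of queries
  without repetition bounds the length of a run.\<close>

lemma reaches_invariant:
  assumes "reaches (winning_algorithm \<gamma>) P w h"
  shows "queried h \<subseteq> edges P \<and> agree (queried h) (reveal h (prediction P)) w \<and>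
    win (queried h) (reveal h (prediction P)) \<and> card (queried h) = length h"
  using assms
proof induction
  case start
  show ?case using win_start adm_w unfolding queried_def reveal_def agree_def by simp
next
  case (query h e)
  let ?v = "reveal h (prediction P)"
  have fin: "finite (queried h)" unfolding queried_def by simp
  have IH: "queried h \<subseteq> edges P" "agree (queried h) ?v w" "win (queried h) ?v" "card (queried h) = length h"
    using query.IH by auto
  have nf: "\<not> feas (queried h) ?v"
    using query.hyps(2) agree_congs(5)[OF IH(2)] unfolding feasible_iff by simp
  have "\<exists>e. winning_query \<gamma> P h e"
    using IH(3)
  proof cases
    case (win_query e)
    then show ?thesis unfolding winning_query_def game_win_def uncertainty_interval_eq by blast
  qed (use nf in blast)
  then have "winning_query \<gamma> P h e"
    using query.hyps(3) unfolding winning_algorithm_def by (metis someI_ex)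
  then have e: "e \<in> edges P" "e \<notin> queried h" "win (insert e (queried h)) (?v(e := w e))"
    using inst unfolding winning_query_def game_win_def mst_instance_def by auto
  have q: "queried (h @ [(e, w e)]) = insert e (queried h)" unfolding queried_def by simp
  have r: "reveal (h @ [(e, w e)]) (prediction P) = ?v(e := w e)" unfolding reveal_def by simp
  have "agree (insert e (queried h)) (?v(e := w e)) w" using IH(2) unfolding agree_def by auto
  then show ?case unfolding q r using IH(1,4) e fin by (simp add: fun_upd_def)
qed

lemma winning_algorithm_final: "\<exists>Q. final_query_set (winning_algorithm \<gamma>) P w Q"
proof (rule ccontr)
  assume no: "\<not> ?thesis"
  have "\<exists>h. reaches (winning_algorithm \<gamma>) P w h \<and> length h = n" for n
  proof (induction n)
    case 0
    show ?case using reaches.start by force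
  next
    case (Suc n)
    then obtain h where h: "reaches (winning_algorithm \<gamma>) P w h" "length h = n" by blast
    have "\<not> feasible_query_set P w (queried h)" using no h unfolding final_query_set_def by blast
    from reaches.query[OF h(1) this refl] show ?case using h(2) by force
  qed
  then obtain h where h: "reaches (winning_algorithm \<gamma>) P w h" "length h = Suc (card (edges P))" by blast
  then have "Suc (card (edges P)) \<le> card (edges P)"
    using reaches_invariant[OF h(1)] card_mono[OF finite_E, of "queried h"] by simp
  then show False by simp
qed

lemma winning_algorithm_good:
  assumes "final_query_set (winning_algorithm \<gamma>) P w Q"
  shows "good w Q"
  using assms reaches_invariant good_win unfolding final_query_set_def by blast

end

theorem theorem4p2:
  fixes \<gamma> :: int
  assumes "\<gamma> \<ge> 2"
  shows "\<exists>A :: ('v, 'e) query_algorithm.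
    consistent (1 + 1 / real_of_int \<gamma>) A \<and> robust (real_of_int \<gamma>) A"
proof (intro exI conjI)
  define g where "g = nat \<gamma>"
  have g: "2 \<le> g" "real_of_int \<gamma> = real g" using assms unfolding g_def by auto
  let ?A = "winning_algorithm g :: ('v, 'e) query_algorithm"
  have main: "\<exists>ALG. final_query_set ?A P w ALG \<and> (\<forall>OPT. optimal_query_set P w OPT \<longrightarrow>
      card ALG \<le> g * card OPT \<and>
      ((\<forall>e\<in>edges P. w e = prediction P e) \<longrightarrow> g * card ALG \<le> (g + 1) * card OPT))"
    if "mst_instance P w" for P :: "('v, 'e) mst_input" and w
  proof -
    interpret mst_game P w g by unfold_locales (use that g in auto)
    obtain Q where Q: "final_query_set ?A P w Q" using winning_algorithm_final by blast
    then have "good w Q" by (rule winning_algorithm_good)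
    \<comment> \<open>An optimal set is one of the feasible sets that \<open>good\<close> ranges
      over.\<close>
    moreover have "feas OPT w" if "optimal_query_set P w OPT" for OPT
      using that unfolding optimal_query_set_def is_arg_min_def feasible_iff by blast
    ultimately show ?thesis using Q unfolding good_def by blast
  qed
  show "robust (real_of_int \<gamma>) ?A"
    unfolding robust_def competitive_on_def
  proof (intro allI impI)
    fix P :: "('v, 'e) mst_input" and w assume "mst_instance P w \<and> True"
    then obtain ALG where ALG: "final_query_set ?A P w ALG"
      "\<And>OPT. optimal_query_set P w OPT \<Longrightarrow> card ALG \<le> g * card OPT"
      using main by blast
    have "real (card ALG) \<le> real_of_int \<gamma> * real (card OPT)" if "optimal_query_set P w OPT" for OPT
      using ALG(2)[OF that] unfolding g(2) by (metis of_nat_le_iff of_nat_mult)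
    then show "\<exists>ALG. final_query_set ?A P w ALG \<and> (\<forall>OPT. optimal_query_set P w OPT \<longrightarrow>
        real (card ALG) \<le> real_of_int \<gamma> * real (card OPT))"
      using ALG(1) by blast
  qed
  show "consistent (1 + 1 / real_of_int \<gamma>) ?A"
    unfolding consistent_def competitive_on_def
  proof (intro allI impI)
    fix P :: "('v, 'e) mst_input" and w
    assume a: "mst_instance P w \<and> (\<forall>e\<in>edges P. prediction P e = w e)"
    then have "\<forall>e\<in>edges P. w e = prediction P e" by simp
    then obtain ALG where ALG: "final_query_set ?A P w ALG"
      "\<And>OPT. optimal_query_set P w OPT \<Longrightarrow> g * card ALG \<le> (g + 1) * card OPT"
      using main a by metis
    have "real (card ALG) \<le> (1 + 1 / real_of_int \<gamma>) * real (card OPT)"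
      if "optimal_query_set P w OPT" for OPT
    proof -
      have "real g * real (card ALG) \<le> (real g + 1) * real (card OPT)"
        using ALG(2)[OF that] by (metis of_nat_1 of_nat_add of_nat_le_iff of_nat_mult)
      then show ?thesis using g by (simp add: field_simps)
    qed
    then show "\<exists>ALG. final_query_set ?A P w ALG \<and> (\<forall>OPT. optimal_query_set P w OPT \<longrightarrow>
        real (card ALG) \<le> (1 + 1 / real_of_int \<gamma>) * real (card OPT))"
      using ALG(1) by blast
  qed
qed

end
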